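(* Let $n\in\mathbb{Z}$ and let $f,h\in\mathcal{A}(\mathbb{C}\mathrm{P}_q^1)$ be such that $f-h$ is non-scalar and $$\|\overline\partial f\|_{\mathrm{op}}+\|\overline\partial h\|_{\mathrm{op}}<\min\left\{\frac13,\ \frac{1-2\|h-f-\psi_\infty(h-f)\|_{C(\mathbb{C}\mathrm{P}_q^1)}}{M}\right\}.$$ Then $\overline{\nabla}^{(n)}_{\overline\partial f}$ and $\overline{\nabla}^{(n)}_{\overline\partial h}$ are gauge equivalent holomorphic structures on $\mathcal{L}_n$.
   Context: Fix a real number $0<q<1$. $\mathcal{A}(SU_q(2))$ is the unital $*$-algebra generated by $a,c$ with relations $ac=qca$, $ac^*=qc^*a$, $cc^*=c^*c$, $a^*a+c^*c=1$, $aa^*+q^2cc^*=1$; $C(SU_q(2))$ is the corresponding universal $C^*$-algebra, and $L^2(SU_q(2))$ its GNS space for the Haar state $\mathsf{h}$, with inner product $\langle x,y\rangle=\mathsf{h}(x^*y)$. $K\triangleright$ denotes the algebra automorphism of $\mathcal{A}(SU_q(2))$ with $K\triangleright a=q^{-1/2}a$, $K\triangleright c=q^{-1/2}c$, $K\triangleright a^*=q^{1/2}a^*$, $K\triangleright c^*=q^{1/2}c^*$ (with inverse $K^{-1}\triangleright$), and $F\triangleright$ is the linear map with $F\triangleright 1=F\triangleright a=F\triangleright c=0$, $F\triangleright a^*=c$, $F\triangleright c^*=-q^{-1}a$ and $F\triangleright(xy)=(F\triangleright x)(K\triangleright y)+(K^{-1}\triangleright x)(F\triangleright y)$. For $n\in\mathbb{Z}$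 put $\mathcal{L}_n=\{x\in\mathcal{A}(SU_q(2)):K\triangleright x=q^{n/2}x\}$; one has $F\triangleright\mathcal{L}_n\subseteq\mathcal{L}_{n-2}$. $\mathcal{A}(\mathbb{C}\mathrm{P}_q^1):=\mathcal{L}_0$, and $C(\mathbb{C}\mathrm{P}_q^1)$ is its norm closure in $C(SU_q(2))$. $H_\pm$ is the closure of $\mathcal{L}_{\pm1}$ in $L^2(SU_q(2))$; $C(\mathbb{C}\mathrm{P}_q^1)$ acts on $H_+$ and $H_-$ by left multiplication (representations $\pi_\pm$). For $f\in\mathcal{A}(\mathbb{C}\mathrm{P}_q^1)$, $\overline\partial f\in\mathcal{B}(H_+,H_-)$ is the bounded extension of left multiplication by $q^{-1/2}(F\triangleright f)\in\mathcal{L}_{-2}$ (up to a fixed unimodular scalar, which plays no role). Products $xT$, $Tx$ of $T\in\mathcal{B}(H_+,H_-)$ with $x\in C(\mathbb{C}\mathrm{P}_q^1)$ mean $\pi_-(x)T$, $T\pi_+(x)$; with this, $\overline\partial$ is a closable derivation. $\mathscr{D}\subseteq C(\mathbb{C}\mathrm{P}_q^1)$ is the domain of its closure, still denoted $\overline\partial$: $x\in\mathscr{D}$ iff there are $x_k\in\mathcal{A}(\mathbb{C}\mathrm{P}_q^1)$ with $x_k\to x$ in $C^*$-norm and $\overline\partial x_k$ convergent in operator norm (to $\overline\partial x$). With the graph norm $\|x\|_{\mathrm{Gr}}=\|x\|_{C(\mathbb{C}\mathrm{P}_q^1)}+\|\overline\partial x\|_{\mathrm{op}}$, $\mathscr{D}$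 is a unital Banach algebra; "invertible in $\mathscr{D}$" means the inverse lies in $\mathscr{D}$. $\psi_\infty$ is the unique character of $C(\mathbb{C}\mathrm{P}_q^1)\cong\mathcal{K}(\ell^2(\mathbb{N}))\oplus\mathbb{C}$, $\psi_\infty(x\oplus\lambda)=\lambda$. The quantum integral $\int$ (of Aguilar and Kaad) is used restricted to the operator-norm closure $\overline{\overline\partial(\mathcal{A}(\mathbb{C}\mathrm{P}_q^1))}\subseteq\mathcal{B}(H_+,H_-)$; there it is the bounded linear operator into $C(\mathbb{C}\mathrm{P}_q^1)$ determined by $\int\overline\partial x=x-\psi_\infty(x)1$ for $x\in\mathcal{A}(\mathbb{C}\mathrm{P}_q^1)$. $M$ denotes the operator norm of this restricted operator (so $M\le 2\sqrt{1-q^2}\,(1-q)^{-2}$). Holomorphic structures: $\Omega^{0,1}(\mathbb{C}\mathrm{P}_q^1)=\mathcal{L}_{-2}\,\omega_-$ with $\omega_-=c^*da^*-qa^*dc^*$ is the bimodule of $(0,1)$-forms, with differential $\overline\partial f=(X_-\triangleright f)\omega_-$, $X_-=q^{-1/2}FK$. The standard holomorphic structure on $\mathcal{L}_n$ is the flat $\overline\partial$-connection $\overline\nabla^{(n)}_0\phi=q^{-n+2}\omega_-(X_-\triangleright\phi)$. For $f\in\mathcal{A}(\mathbb{C}\mathrm{P}_q^1)$, $\overline\nabla^{(n)}_{\overline\partial f}(s)=\overline\nabla^{(n)}_0(s)-\Phi_{(n)}(s\otimes\overline\partial f)$, where $\Phi_{(n)}:\mathcal{L}_n\otimes_{\mathcal{A}(\mathbb{C}\mathrm{P}_q^1)}\Omega^{0,1}\to\Omega^{0,1}\otimes_{\mathcal{A}(\mathbb{C}\mathrm{P}_q^1)}\mathcal{L}_n$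 is the bimodule isomorphism (twisted flip) with $\overline\nabla^{(n)}_0(sx)=\overline\nabla^{(n)}_0(s)x+\Phi_{(n)}(s\otimes\overline\partial x)$. By definition, $\overline\nabla^{(n)}_{\overline\partial f}$ and $\overline\nabla^{(n)}_{\overline\partial h}$ are gauge equivalent if the mixed gauge equation $\overline\partial g=g\,\overline\partial f-\overline\partial h\cdot g$ has a solution $g\in\mathscr{D}$ that is invertible in $\mathscr{D}$. *)

theory Defs
  imports "HOL-Analysis.Analysis" "HOL-Library.Poly_Mapping" "HOL-Library.Product_Plus"
begin

section \<open>Unital C*-algebras and complex Hilbert spaces\<close>

class complex_vector = real_vector +
  fixes scaleC :: "complex \<Rightarrow> 'a \<Rightarrow> 'a" (infixr "*\<^sub>C" 75)
  assumes scaleC_add_right: "z *\<^sub>C (x + y) = z *\<^sub>C x + z *\<^sub>C y"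
    and scaleC_add_left: "(z + w) *\<^sub>C x = z *\<^sub>C x + w *\<^sub>C x"
    and scaleC_scaleC: "z *\<^sub>C w *\<^sub>C x = (z * w) *\<^sub>C x"
    and scaleR_scaleC: "r *\<^sub>R x = complex_of_real r *\<^sub>C x"

class cstar_algebra = complex_vector + real_normed_algebra_1 + banach +
  fixes star :: "'a \<Rightarrow> 'a"
  assumes mult_scaleC_left: "(z *\<^sub>C x) * y = z *\<^sub>C (x * y)"
    and mult_scaleC_right: "x * (z *\<^sub>C y) = z *\<^sub>C (x * y)"
    and star_add: "star (x + y) = star x + star y"
    and star_scaleC: "star (z *\<^sub>C x) = cnj z *\<^sub>C star x"
    and star_mult: "star (x * y) = star y * star x"
    and star_star: "star (star x) = x"
    and cstar_identity: "norm (star x * x) = (norm x)\<^sup>2"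

text \<open>The inner product is linear in the second variable.\<close>

class complex_hilbert = complex_vector + banach +
  fixes cinner :: "'a \<Rightarrow> 'a \<Rightarrow> complex"
  assumes cinner_add_right: "cinner x (y + y') = cinner x y + cinner x y'"
    and cinner_scaleC_right: "cinner x (z *\<^sub>C y) = z * cinner x y"
    and cinner_commute: "cinner y x = cnj (cinner x y)"
    and cinner_norm: "cinner x x = complex_of_real ((norm x)\<^sup>2)"

definition complex_linear_on :: "'a::complex_vector set \<Rightarrow> ('a \<Rightarrow> 'b::complex_vector) \<Rightarrow> bool" where
  "complex_linear_on V f \<longleftrightarrow>
     (\<forall>x\<in>V. \<forall>y\<in>V. f (x + y) = f x + f y) \<and> (\<forall>z. \<forall>x\<in>V. f (z *\<^sub>C x) = z *\<^sub>C f x)"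

instantiation complex :: complex_vector
begin
definition scaleC_complex :: "complex \<Rightarrow> complex \<Rightarrow> complex" where
  "scaleC_complex z w = z * w"
instance
  by standard (simp_all add: scaleC_complex_def algebra_simps scaleR_conv_of_real)
end

section \<open>The free *-algebra on a and c, and the relations of SU_q(2)\<close>

text \<open>Noncommutative polynomials in a, a*, c, c* are the elements of the monoid algebra of the
  free monoid on four letters; multiplication of finitely supported functions is
  the convolution product.\<close>

datatype letter = LA | LAs | LC | LCs

datatype ncword = NCW (letters: "letter list")

instantiation ncword :: monoid_add
begin
definition zero_ncword :: ncword where "zero_ncword = NCW []"
definition plus_ncword :: "ncword \<Rightarrow> ncword \<Rightarrow> ncword" where
  "plus_ncword u v = NCW (letters u @ letters v)"
instance
  by standard (simp_all add: zero_ncword_def plus_ncword_def)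
end

type_synonym ncpoly = "ncword \<Rightarrow>\<^sub>0 complex"

definition ncmono :: "letter list \<Rightarrow> ncpoly" where
  "ncmono ls = Poly_Mapping.single (NCW ls) 1"

definition ncconst :: "complex \<Rightarrow> ncpoly" where
  "ncconst z = Poly_Mapping.single 0 z"

fun letter_star :: "letter \<Rightarrow> letter" where
  "letter_star LA = LAs"
| "letter_star LAs = LA"
| "letter_star LC = LCs"
| "letter_star LCs = LC"

definition ncstar :: "ncpoly \<Rightarrow> ncpoly" where
  "ncstar p = (\<Sum>w\<in>Poly_Mapping.keys p.
     Poly_Mapping.single (NCW (rev (map letter_star (letters w)))) (cnj (Poly_Mapping.lookup p w)))"

definition relators :: "real \<Rightarrow> ncpoly set" where
  "relators q =
    { ncmono [LA, LC] - ncconst (of_real q) * ncmono [LC, LA],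
      ncmono [LA, LCs] - ncconst (of_real q) * ncmono [LCs, LA],
      ncmono [LC, LCs] - ncmono [LCs, LC],
      ncmono [LAs, LA] + ncmono [LCs, LC] - 1,
      ncmono [LA, LAs] + ncconst (of_real (q\<^sup>2)) * ncmono [LC, LCs] - 1 }"

inductive_set relation_ideal :: "real \<Rightarrow> ncpoly set" for q :: real where
  zero: "0 \<in> relation_ideal q"
| relator: "r \<in> relators q \<Longrightarrow> r \<in> relation_ideal q"
| add: "x \<in> relation_ideal q \<Longrightarrow> y \<in> relation_ideal q \<Longrightarrow> x + y \<in> relation_ideal q"
| mult: "x \<in> relation_ideal q \<Longrightarrow> p * x * r \<in> relation_ideal q"
| star: "x \<in> relation_ideal q \<Longrightarrow> ncstar x \<in> relation_ideal q"

fun letter_val :: "'b::cstar_algebra \<Rightarrow> 'b \<Rightarrow> letter \<Rightarrow> 'b" where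
  "letter_val a c LA = a"
| "letter_val a c LAs = star a"
| "letter_val a c LC = c"
| "letter_val a c LCs = star c"

definition word_val :: "'b::cstar_algebra \<Rightarrow> 'b \<Rightarrow> ncword \<Rightarrow> 'b" where
  "word_val a c w = prod_list (map (letter_val a c) (letters w))"

definition nceval :: "'b::cstar_algebra \<Rightarrow> 'b \<Rightarrow> ncpoly \<Rightarrow> 'b" where
  "nceval a c p = (\<Sum>w\<in>Poly_Mapping.keys p. Poly_Mapping.lookup p w *\<^sub>C word_val a c w)"

text \<open>The coproduct on the free algebra, induced by the fundamental corepresentation with
  rows (a, -q c*) and (c, a*). The free algebra tensored with itself is the monoid algebra of pairs
  of words, a pair (u, v) standing for u \<open>\<otimes>\<close> v.\<close>

definition tens :: "letter \<Rightarrow> letter \<Rightarrow> (ncword \<times> ncword) \<Rightarrow>\<^sub>0 complex" where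
  "tens l m = Poly_Mapping.single (NCW [l], NCW [m]) 1"

fun coproduct_letter :: "real \<Rightarrow> letter \<Rightarrow> (ncword \<times> ncword) \<Rightarrow>\<^sub>0 complex" where
  "coproduct_letter q LA = tens LA LA - Poly_Mapping.single 0 (of_real q) * tens LCs LC"
| "coproduct_letter q LAs = tens LAs LAs - Poly_Mapping.single 0 (of_real q) * tens LC LCs"
| "coproduct_letter q LC = tens LC LA + tens LAs LC"
| "coproduct_letter q LCs = tens LCs LAs + tens LA LCs"

definition coproduct :: "real \<Rightarrow> ncpoly \<Rightarrow> (ncword \<times> ncword) \<Rightarrow>\<^sub>0 complex" where
  "coproduct q p = (\<Sum>w\<in>Poly_Mapping.keys p.
     Poly_Mapping.single 0 (Poly_Mapping.lookup p w)
       * prod_list (map (coproduct_letter q) (letters w)))"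

section \<open>The quantum group SU_q(2)\<close>

text \<open>The data of the quantum group. The type \<open>'b\<close> is C(SU_q(2)) and \<open>'h\<close> is L2(SU_q(2));
  \<open>act_K\<close> and \<open>act_F\<close> are only meaningful on the polynomial subalgebra A(SU_q(2)).\<close>

record ('b, 'h) su2 =
  qpar :: real
  gen_a :: 'b
  gen_c :: 'b
  act_K :: "'b \<Rightarrow> 'b"
  act_F :: "'b \<Rightarrow> 'b"
  haar :: "'b \<Rightarrow> complex"
  gns_vec :: "'b \<Rightarrow> 'h"

definition ASU :: "('b::cstar_algebra, 'h) su2 \<Rightarrow> 'b set" where
  "ASU G = range (nceval (gen_a G) (gen_c G))"

text \<open>A(SU_q(2)) is presented by the relations: the kernel of the evaluation at a, c is
  exactly the *-ideal generated by them.\<close>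

definition presented :: "('b::cstar_algebra, 'h) su2 \<Rightarrow> bool" where
  "presented G \<longleftrightarrow> (\<forall>p. nceval (gen_a G) (gen_c G) p = 0 \<longleftrightarrow> p \<in> relation_ideal (qpar G))"

definition cstar_seminorm_on :: "'b::cstar_algebra set \<Rightarrow> ('b \<Rightarrow> real) \<Rightarrow> bool" where
  "cstar_seminorm_on A \<nu> \<longleftrightarrow>
     (\<forall>x\<in>A. 0 \<le> \<nu> x) \<and>
     (\<forall>x\<in>A. \<forall>y\<in>A. \<nu> (x + y) \<le> \<nu> x + \<nu> y) \<and>
     (\<forall>z. \<forall>x\<in>A. \<nu> (z *\<^sub>C x) = cmod z * \<nu> x) \<and>
     (\<forall>x\<in>A. \<forall>y\<in>A. \<nu> (x * y) \<le> \<nu> x * \<nu> y) \<and>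
     (\<forall>x\<in>A. \<nu> (star x * x) = (\<nu> x)\<^sup>2)"

text \<open>\<open>'b\<close> is the completion of A(SU_q(2)) in its largest C*-seminorm (which is a norm).\<close>

definition universal_completion :: "('b::cstar_algebra, 'h) su2 \<Rightarrow> bool" where
  "universal_completion G \<longleftrightarrow>
     closure (ASU G) = UNIV \<and>
     (\<forall>\<nu>. cstar_seminorm_on (ASU G) \<nu> \<longrightarrow> (\<forall>x\<in>ASU G. \<nu> x \<le> norm x))"

definition K_spec :: "('b::cstar_algebra, 'h) su2 \<Rightarrow> bool" where
  "K_spec G \<longleftrightarrow>
     (let q = qpar G; a = gen_a G; c = gen_c G; K = act_K G in
       bij_betw K (ASU G) (ASU G) \<and>
       complex_linear_on (ASU G) K \<and>
       K 1 = 1 \<and>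
       (\<forall>x\<in>ASU G. \<forall>y\<in>ASU G. K (x * y) = K x * K y) \<and>
       K a = (q powr (-1/2)) *\<^sub>R a \<and>
       K c = (q powr (-1/2)) *\<^sub>R c \<and>
       K (star a) = (q powr (1/2)) *\<^sub>R star a \<and>
       K (star c) = (q powr (1/2)) *\<^sub>R star c)"

definition act_Kinv :: "('b::cstar_algebra, 'h) su2 \<Rightarrow> 'b \<Rightarrow> 'b" where
  "act_Kinv G = inv_into (ASU G) (act_K G)"

definition F_spec :: "('b::cstar_algebra, 'h) su2 \<Rightarrow> bool" where
  "F_spec G \<longleftrightarrow>
     (let q = qpar G; a = gen_a G; c = gen_c G; F = act_F G in
       F ` ASU G \<subseteq> ASU G \<and>
       complex_linear_on (ASU G) F \<and>
       (\<forall>x\<in>ASU G. \<forall>y\<in>ASU G. F (x * y) = F x * act_K G y + act_Kinv G x * F y) \<and>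
       F 1 = 0 \<and> F a = 0 \<and> F c = 0 \<and>
       F (star a) = c \<and>
       F (star c) = - ((1 / q) *\<^sub>R a))"

text \<open>The Haar state: the state on C(SU_q(2)) which is left and right invariant, i.e.
  (id \<open>\<otimes>\<close> h) \<open>\<Delta>\<close>(x) = h(x) 1 = (h \<open>\<otimes>\<close> id) \<open>\<Delta>\<close>(x) for x in A(SU_q(2)).\<close>

definition haar_spec :: "('b::cstar_algebra, 'h) su2 \<Rightarrow> bool" where
  "haar_spec G \<longleftrightarrow>
     (let h = haar G; val = word_val (gen_a G) (gen_c G); ev = nceval (gen_a G) (gen_c G);
          \<Delta> = coproduct (qpar G) in
       complex_linear_on UNIV h \<and>
       (\<forall>x. \<exists>r\<ge>0. h (star x * x) = complex_of_real r) \<and>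
       h 1 = 1 \<and>
       (\<forall>p. (\<Sum>(u, v)\<in>Poly_Mapping.keys (\<Delta> p).
               (Poly_Mapping.lookup (\<Delta> p) (u, v) * h (val v)) *\<^sub>C val u) = h (ev p) *\<^sub>C 1) \<and>
       (\<forall>p. (\<Sum>(u, v)\<in>Poly_Mapping.keys (\<Delta> p).
               (Poly_Mapping.lookup (\<Delta> p) (u, v) * h (val u)) *\<^sub>C val v) = h (ev p) *\<^sub>C 1))"

definition gns_spec :: "('b::cstar_algebra, 'h::complex_hilbert) su2 \<Rightarrow> bool" where
  "gns_spec G \<longleftrightarrow>
     complex_linear_on UNIV (gns_vec G) \<and>
     (\<forall>x y. cinner (gns_vec G x) (gns_vec G y) = haar G (star x * y)) \<and>
     closure (range (gns_vec G)) = UNIV"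

definition quantum_SU2 :: "real \<Rightarrow> ('b::cstar_algebra, 'h::complex_hilbert) su2 \<Rightarrow> bool" where
  "quantum_SU2 q G \<longleftrightarrow>
     qpar G = q \<and> presented G \<and> universal_completion G \<and>
     K_spec G \<and> F_spec G \<and> haar_spec G \<and> gns_spec G"

section \<open>The quantum projective line\<close>

definition line_bundle :: "('b::cstar_algebra, 'h) su2 \<Rightarrow> int \<Rightarrow> 'b set" where
  "line_bundle G n = {x \<in> ASU G. act_K G x = (qpar G powr (of_int n / 2)) *\<^sub>R x}"

definition ACP :: "('b::cstar_algebra, 'h) su2 \<Rightarrow> 'b set" where
  "ACP G = line_bundle G 0"

definition CCP :: "('b::cstar_algebra, 'h) su2 \<Rightarrow> 'b set" where
  "CCP G = closure (ACP G)"

definition gns_rep :: "('b::cstar_algebra, 'h::complex_hilbert) su2 \<Rightarrow> 'b \<Rightarrow> 'h \<Rightarrow>\<^sub>L 'h" where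
  "gns_rep G x = (THE T. \<forall>y. blinfun_apply T (gns_vec G y) = gns_vec G (x * y))"

definition Hplus :: "('b::cstar_algebra, 'h::complex_hilbert) su2 \<Rightarrow> 'h set" where
  "Hplus G = closure (gns_vec G ` line_bundle G 1)"

definition orth_proj :: "'h::complex_hilbert set \<Rightarrow> 'h \<Rightarrow>\<^sub>L 'h" where
  "orth_proj S = (THE P. (\<forall>\<xi>\<in>S. blinfun_apply P \<xi> = \<xi>) \<and>
     (\<forall>\<xi>. (\<forall>\<eta>\<in>S. cinner \<eta> \<xi> = 0) \<longrightarrow> blinfun_apply P \<xi> = 0))"

text \<open>B(H_+, H_-) is embedded isometrically in B(L2(SU_q(2))) by extending operators by zero on the
  orthogonal complement of H_+. Left multiplication by an element of L_{-2} maps H_+ to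
  H_- (the closure of L_{-1}), and left multiplication by an element of C(CP^1_q) preserves
  H_+, H_- and their orthogonal complements. Hence in this picture the products
  \<open>\<pi>\<^sub>-(x) T\<close> and \<open>T \<pi>\<^sub>+(x)\<close> are the compositions with \<open>gns_rep G x\<close>.\<close>

definition dbar :: "('b::cstar_algebra, 'h::complex_hilbert) su2 \<Rightarrow> 'b \<Rightarrow> 'h \<Rightarrow>\<^sub>L 'h" where
  "dbar G f = gns_rep G ((qpar G powr (-1/2)) *\<^sub>R act_F G f) o\<^sub>L orth_proj (Hplus G)"

text \<open>The derivation is closable; \<open>has_dbar G x T\<close> says that x lies in the domain of its closure
  and that the closure maps x to T.\<close>

definition has_dbar :: "('b::cstar_algebra, 'h::complex_hilbert) su2 \<Rightarrow> 'b \<Rightarrow> ('h \<Rightarrow>\<^sub>L 'h) \<Rightarrow> bool" where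
  "has_dbar G x T \<longleftrightarrow>
     (\<exists>X. (\<forall>k. X k \<in> ACP G) \<and> X \<longlonglongrightarrow> x \<and> (\<lambda>k. dbar G (X k)) \<longlonglongrightarrow> T)"

definition dbar_domain :: "('b::cstar_algebra, 'h::complex_hilbert) su2 \<Rightarrow> 'b set" where
  "dbar_domain G = {x. \<exists>T. has_dbar G x T}"

definition invertible_in :: "'b::cstar_algebra set \<Rightarrow> 'b \<Rightarrow> bool" where
  "invertible_in D g \<longleftrightarrow> g \<in> D \<and> (\<exists>g'\<in>D. g * g' = 1 \<and> g' * g = 1)"

definition is_character :: "('b::cstar_algebra, 'h) su2 \<Rightarrow> ('b \<Rightarrow> complex) \<Rightarrow> bool" where
  "is_character G \<phi> \<longleftrightarrow>
     complex_linear_on (CCP G) \<phi> \<and>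
     (\<forall>x\<in>CCP G. \<forall>y\<in>CCP G. \<phi> (x * y) = \<phi> x * \<phi> y) \<and>
     (\<exists>x\<in>CCP G. \<phi> x \<noteq> 0)"

text \<open>The value at x of the unique character of C(CP^1_q) (unique as a function on C(CP^1_q)).\<close>

definition psi_inf :: "('b::cstar_algebra, 'h) su2 \<Rightarrow> 'b \<Rightarrow> complex" where
  "psi_inf G x = (THE z. \<forall>\<phi>. is_character G \<phi> \<longrightarrow> \<phi> x = z)"

text \<open>The quantum integral on the closure of the range of \<open>dbar G\<close>, given by its graph: the
  extension by continuity of the map sending \<open>dbar G x\<close> to \<open>x - psi_inf G x\<close>. It is bounded, so
  this relation is a function. Its operator norm is taken as an extended real supremum.\<close>

definition has_qintegral ::
    "('b::cstar_algebra, 'h::complex_hilbert) su2 \<Rightarrow> ('h \<Rightarrow>\<^sub>L 'h) \<Rightarrow> 'b \<Rightarrow> bool" where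
  "has_qintegral G T y \<longleftrightarrow>
     (\<exists>X. (\<forall>k. X k \<in> ACP G) \<and> (\<lambda>k. dbar G (X k)) \<longlonglongrightarrow> T \<and>
          (\<lambda>k. X k - psi_inf G (X k) *\<^sub>C 1) \<longlonglongrightarrow> y)"

definition qintegral_norm :: "('b::cstar_algebra, 'h::complex_hilbert) su2 \<Rightarrow> ereal" where
  "qintegral_norm G = Sup {ereal (norm y) | T y. has_qintegral G T y \<and> norm T \<le> 1}"

section \<open>Holomorphic structures on line bundles\<close>

text \<open>Write K2 for the square of K. In the left covariant calculus on SU_q(2) the form
  \<open>\<omega>\<^sub>-\<close> = c* da* - q a* dc* is a free left module generator of its bimodule over A(SU_q(2)), with
  \<open>\<omega>\<^sub>- x = (K2 x) \<omega>\<^sub>-\<close>. The form \<open>y \<omega>\<^sub>-\<close> is represented by its left coefficient y, so the left action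
  is multiplication and the right action is \<open>form_rmult\<close>. In particular \<open>\<omega>\<^sub>- y\<close> is represented by
  \<open>form_rmult G 1 y\<close>.\<close>

definition X_minus :: "('b::cstar_algebra, 'h) su2 \<Rightarrow> 'b \<Rightarrow> 'b" where
  "X_minus G x = (qpar G powr (-1/2)) *\<^sub>R act_F G (act_K G x)"

definition form_rmult :: "('b::cstar_algebra, 'h) su2 \<Rightarrow> 'b \<Rightarrow> 'b \<Rightarrow> 'b" where
  "form_rmult G y x = y * act_K G (act_K G x)"

definition Omega01 :: "('b::cstar_algebra, 'h) su2 \<Rightarrow> 'b set" where
  "Omega01 G = line_bundle G (-2)"

definition dbar_form :: "('b::cstar_algebra, 'h) su2 \<Rightarrow> 'b \<Rightarrow> 'b" where
  "dbar_form G f = X_minus G f"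

text \<open>The balanced tensor product of \<open>\<Omega>\<^sup>0\<^sup>,\<^sup>1\<close> and L_n over A(CP^1_q), realised as its (isomorphic)
  image under the product map \<open>\<eta> \<otimes> s \<mapsto> \<eta> s\<close>. The tensor product in the opposite order is
  treated in the same way, and the twisted flip \<open>\<Phi>\<close> maps the class of \<open>s \<otimes> \<eta>\<close> to \<open>s \<eta>\<close>.\<close>

definition Omega01_tensor :: "('b::cstar_algebra, 'h) su2 \<Rightarrow> int \<Rightarrow> 'b set" where
  "Omega01_tensor G n =
     {\<Sum>i<k. form_rmult G (\<eta> i) (s i) | (k::nat) \<eta> s.
        (\<forall>i<k. \<eta> i \<in> Omega01 G) \<and> (\<forall>i<k. s i \<in> line_bundle G n)}"

definition twisted_flip :: "'b::cstar_algebra \<Rightarrow> 'b \<Rightarrow> 'b" where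
  "twisted_flip s \<eta> = s * \<eta>"

definition nabla_std :: "('b::cstar_algebra, 'h) su2 \<Rightarrow> int \<Rightarrow> 'b \<Rightarrow> 'b" where
  "nabla_std G n s = (qpar G powr of_int (2 - n)) *\<^sub>R form_rmult G 1 (X_minus G s)"

definition nabla :: "('b::cstar_algebra, 'h) su2 \<Rightarrow> int \<Rightarrow> 'b \<Rightarrow> 'b \<Rightarrow> 'b" where
  "nabla G n f s = nabla_std G n s - twisted_flip s (dbar_form G f)"

text \<open>Flat connections for the \<open>\<partial>\<close>-bar operator on the left module L_n. Flatness is no condition
  since there are no (0,2)-forms.\<close>

definition holomorphic_structure :: "('b::cstar_algebra, 'h) su2 \<Rightarrow> int \<Rightarrow> ('b \<Rightarrow> 'b) \<Rightarrow> bool" where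
  "holomorphic_structure G n N \<longleftrightarrow>
     N ` line_bundle G n \<subseteq> Omega01_tensor G n \<and>
     complex_linear_on (line_bundle G n) N \<and>
     (\<forall>x\<in>ACP G. \<forall>s\<in>line_bundle G n. N (x * s) = x * N s + form_rmult G (dbar_form G x) s)"

definition mixed_gauge_solution ::
    "('b::cstar_algebra, 'h::complex_hilbert) su2 \<Rightarrow> 'b \<Rightarrow> 'b \<Rightarrow> 'b \<Rightarrow> bool" where
  "mixed_gauge_solution G f h g \<longleftrightarrow>
     has_dbar G g ((gns_rep G g o\<^sub>L dbar G f) - (dbar G h o\<^sub>L gns_rep G g))"

definition gauge_equivalent ::
    "('b::cstar_algebra, 'h::complex_hilbert) su2 \<Rightarrow> int \<Rightarrow> ('b \<Rightarrow> 'b) \<Rightarrow> ('b \<Rightarrow> 'b) \<Rightarrow> bool" where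
  "gauge_equivalent G n N N' \<longleftrightarrow>
     (\<exists>f\<in>ACP G. \<exists>h\<in>ACP G.
        (\<forall>s\<in>line_bundle G n. N s = nabla G n f s) \<and>
        (\<forall>s\<in>line_bundle G n. N' s = nabla G n h s) \<and>
        (\<exists>g. invertible_in (dbar_domain G) g \<and> mixed_gauge_solution G f h g))"

end

theory Submission
  imports Defs
begin

text \<open>
  The mixed gauge equation is solved by iterating u to a primitive of u (dbar f) - (dbar h) u, starting
  at 1, and summing. Such primitives exist already in the polynomial algebra, because F maps degree 0
  onto degree -2: on the normal form monomials of degree -2 a preimage can be written down.
  Subtracting a scalar, the primitive can be chosen of norm at most M times the norm of the form,
  so the series is dominated by a geometric series of ratio M (|dbar f| + |dbar h|), and the smallness
  assumption gives |g - 1| < 1. The Neumann series of g also converges in the graph norm, since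
  differentiating it term by term costs only a factor linear in the exponent.

  The operators dbar f are realised through the GNS representation (bounded, as 1 - b is a square for
  selfadjoint b of norm less than 1) and the projection onto \<open>H\<^sub>+\<close>, which commutes with degree 0.
\<close>

section \<open>C*-algebras and Hilbert spaces\<close>

text \<open>The integral is controlled only on the closed range of \<open>dbar G\<close>, so M can
  enter an estimate only if the right-hand side of the gauge equation has a primitive. Up to a
  scalar this right-hand side is multiplication by u (F f) - (F h) u, of degree -2, hence by F of
  some polynomial: the iteration never leaves the polynomial algebra, and only its limit needs the
  closure. Since \<open>dbar G\<close> kills scalars, primitives may be normalised by
  \<open>psi_inf\<close>. The first correction is f - h + psi_inf (h - f), whose norm e occurs in
  the hypothesis; each later one gains the ratio r = M (|dbar f| + |dbar h|), so |g - 1| <= e / (1 -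
  r) with r < 1 - 2 e. The norm of the integral is an extended real. It is positive because f - h is
  nonscalar; were it infinite, the quotient in the hypothesis would be 0, and no sum of norms lies
  below 0.\<close>

lemma scaleC_of_real: "complex_of_real r *\<^sub>C x = r *\<^sub>R x"
  by (simp add: scaleR_scaleC)

lemma scaleC_one [simp]: "1 *\<^sub>C x = x"
  using scaleC_of_real[of 1 x] by simp

lemma scaleC_zero_left [simp]: "0 *\<^sub>C x = 0"
  using scaleC_of_real[of 0 x] by simp

lemma scaleC_zero_right [simp]: "z *\<^sub>C 0 = 0"
  using scaleC_add_right[of z 0 0] by simp

lemma scaleC_minus_right: "z *\<^sub>C (- x) = - (z *\<^sub>C x)"
  using scaleC_add_right[of z x "- x"] by (simp add: eq_neg_iff_add_eq_0 add.commute)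

lemma scaleC_diff_right: "z *\<^sub>C (x - y) = z *\<^sub>C x - z *\<^sub>C y"
  using scaleC_add_right[of z x "- y"] by (simp add: scaleC_minus_right)

lemma scaleC_scaleR: "z *\<^sub>C r *\<^sub>R x = r *\<^sub>R z *\<^sub>C x"
  by (simp add: scaleR_scaleC scaleC_scaleC mult.commute)

lemma scaleC_sum_right: "z *\<^sub>C (\<Sum>i\<in>S. u i) = (\<Sum>i\<in>S. z *\<^sub>C u i)"
  by (induction S rule: infinite_finite_induct) (auto simp: scaleC_add_right)

context cstar_algebra
begin

lemma star_zero [simp]: "star 0 = 0"
  using star_add[of 0 0] by simp

lemma star_one [simp]: "star 1 = 1"
  using star_mult[of "star 1" 1] by (simp add: star_star)

lemma star_minus: "star (- x) = - star x"
  using star_add[of x "- x"] by (simp add: eq_neg_iff_add_eq_0 add.commute)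

lemma star_diff: "star (x - y) = star x - star y"
  using star_add[of x "- y"] by (simp add: star_minus)

end

lemma star_scaleR: "star (r *\<^sub>R x) = r *\<^sub>R star (x::'a::cstar_algebra)"
  by (simp add: scaleR_scaleC star_scaleC)

text \<open>The C*-identity gives |y|^2 <= |y*| |y|; cancel |y|, then replace y by y* for the other
  inequality.\<close>

lemma norm_star [simp]: "norm (star x) = norm (x::'a::cstar_algebra)"
proof -
  have le: "norm y \<le> norm (star y)" for y :: 'a
  proof (cases "norm y = 0")
    case False
    have "norm y * norm y = norm (star y * y)"
      by (simp add: cstar_identity power2_eq_square)
    also have "\<dots> \<le> norm (star y) * norm y"
      by (rule norm_mult_ineq)
    finally show ?thesis
      using False by (simp add: mult_le_cancel_right)
  qed auto
  from le[of x] le[of "star x"] show ?thesis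
    by (simp add: star_star)
qed

lemma bounded_linear_star: "bounded_linear (star :: 'a::cstar_algebra \<Rightarrow> 'a)"
  by (rule bounded_linear_intro[of _ 1]) (auto simp: star_add star_scaleR)

text \<open>The solution of t = (b + t^2)/2 near 0 gives the square root 1 - t of 1 - b.\<close>

lemma cstar_sqrt_one_minus:
  fixes b :: "'a::cstar_algebra"
  assumes b: "star b = b" "norm b < 1"
  shows "\<exists>s. star s = s \<and> s * s = 1 - b"
proof -
  let ?r = "norm b"
  \<comment> \<open>On the ball of radius \<open>?r\<close> the map has Lipschitz constant
    \<open>?r\<close> < 1; restricting it to selfadjoint elements makes the root
    selfadjoint.\<close>
  let ?S = "{t::'a. star t = t} \<inter> cball 0 ?r"
  let ?f = "\<lambda>t. (1/2) *\<^sub>R (b + t * t)"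
  have "closed {t::'a. star t = t}"
    by (intro closed_Collect_eq linear_continuous_on bounded_linear_star continuous_on_id)
  then have "complete ?S"
    unfolding complete_eq_closed by (intro closed_Int closed_cball)
  moreover have "0 \<in> ?S"
    by simp
  then have "?S \<noteq> {}"
    by blast
  moreover have "?f ` ?S \<subseteq> ?S"
  proof safe
    fix t :: 'a assume t: "star t = t" "t \<in> cball 0 ?r"
    then show "star (?f t) = ?f t"
      using b by (simp add: star_scaleR star_add star_mult)
    have "norm (t * t) \<le> ?r * 1"
      using t b by (intro order.trans[OF norm_mult_ineq] mult_mono) auto
    then have "norm (b + t * t) \<le> 2 * ?r"
      using norm_triangle_ineq[of b "t * t"] by simp
    then show "?f t \<in> cball 0 ?r"
      by simp
  qed
  moreover have "dist (?f t) (?f u) \<le> ?r * dist t u" if "t \<in> ?S" "u \<in> ?S" for t u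
  proof -
    have "?f t - ?f u = (1/2) *\<^sub>R (t * (t - u) + (t - u) * u)"
      by (simp add: algebra_simps)
    moreover have "norm (t * (t - u)) \<le> ?r * norm (t - u)" "norm ((t - u) * u) \<le> norm (t - u) * ?r"
      using that by (auto intro!: order.trans[OF norm_mult_ineq] mult_mono)
    ultimately show ?thesis
      using norm_triangle_ineq[of "t * (t - u)" "(t - u) * u"]
      by (simp add: dist_norm mult.commute)
  qed
  ultimately have "\<exists>!t. t \<in> ?S \<and> ?f t = t"
    using b by (intro Banach_fix[of ?S ?r]) auto
  then obtain t where t: "star t = t" "?f t = t"
    by auto
  have "b + t * t = 2 *\<^sub>R t"
    using arg_cong[OF t(2), of "\<lambda>x. 2 *\<^sub>R x"] by simp
  then have "(1 - t) * (1 - t) = 1 - b"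
    by (simp add: algebra_simps scaleR_2)
  then show ?thesis
    using t by (intro exI[of _ "1 - t"]) (simp add: star_diff)
qed

subsection \<open>Inner products\<close>

lemma cinner_add_left: "cinner (x + y) z = cinner x z + cinner y z"
  by (metis cinner_add_right cinner_commute complex_cnj_add)

lemma cinner_scaleC_left: "cinner (z *\<^sub>C x) y = cnj z * cinner x y"
  by (metis cinner_scaleC_right cinner_commute complex_cnj_mult)

lemma cinner_scaleR_right: "cinner x (r *\<^sub>R y) = r *\<^sub>R cinner x y"
  by (simp add: scaleR_scaleC[of r y] cinner_scaleC_right scaleR_conv_of_real)

lemma cinner_scaleR_left: "cinner (r *\<^sub>R x) y = r *\<^sub>R cinner x y"
  by (simp add: scaleR_scaleC[of r x] cinner_scaleC_left scaleR_conv_of_real)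

lemma cinner_minus_right: "cinner x (- y) = - cinner x y"
  using cinner_scaleR_right[of x "-1" y] by simp

lemma cinner_diff_right: "cinner x (y - z) = cinner x y - cinner x z"
  using cinner_add_right[of x y "- z"] by (simp add: cinner_minus_right)

lemma cinner_zero_right [simp]: "cinner x 0 = 0"
  using cinner_scaleR_right[of x 0 0] by simp

lemma cinner_eq_zero [simp]: "cinner x x = 0 \<longleftrightarrow> x = 0"
  by (simp add: cinner_norm)

text \<open>The class makes the norm homogeneous for real scalars only; the complex case is read off
  from the inner product.\<close>

lemma norm_scaleC [simp]: "norm (z *\<^sub>C x) = cmod z * norm (x::'a::complex_hilbert)"
proof -
  have "complex_of_real ((norm (z *\<^sub>C x))\<^sup>2) = complex_of_real ((cmod z * norm x)\<^sup>2)"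
    unfolding cinner_norm[symmetric] cinner_scaleC_left cinner_scaleC_right
    by (simp add: cinner_norm power_mult_distrib mult.commute flip: mult.assoc complex_norm_square)
  then show ?thesis
    by (simp only: of_real_eq_iff power2_eq_iff_nonneg norm_ge_zero mult_nonneg_nonneg)
qed

lemma norm_add_square:
  "(norm (x + y))\<^sup>2 = (norm x)\<^sup>2 + 2 * Re (cinner x y) + (norm (y::'a::complex_hilbert))\<^sup>2"
proof -
  have "cinner (x + y) (x + y) = cinner x x + (cinner x y + cnj (cinner x y)) + cinner y y"
    by (simp add: cinner_add_left cinner_add_right add_ac flip: cinner_commute[of y x])
  then have "complex_of_real ((norm (x + y))\<^sup>2)
    = complex_of_real ((norm x)\<^sup>2 + 2 * Re (cinner x y) + (norm y)\<^sup>2)"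
    by (simp add: cinner_norm complex_add_cnj)
  then show ?thesis
    by (simp only: of_real_eq_iff)
qed

lemma parallelogram:
  fixes x y :: "'a::complex_hilbert"
  shows "(norm (x + y))\<^sup>2 + (norm (x - y))\<^sup>2 = 2 * (norm x)\<^sup>2 + 2 * (norm y)\<^sup>2"
  using norm_add_square[of x y] norm_add_square[of x "- y"] by (simp add: cinner_minus_right)

text \<open>The factor <y, x> makes the cross term real, so the squared distance is a real quadratic
  in t. Two choices of t give Cauchy-Schwarz and the orthogonality at closest points.\<close>

lemma norm_diff_scaleC_square:
  fixes x y :: "'a::complex_hilbert"
  defines "c \<equiv> cinner y x"
  shows "(norm (x - (t *\<^sub>R c) *\<^sub>C y))\<^sup>2
    = (norm x)\<^sup>2 - 2 * t * (cmod c)\<^sup>2 + t\<^sup>2 * (cmod c)\<^sup>2 * (norm y)\<^sup>2"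
proof -
  have "c * cinner x y = complex_of_real ((cmod c)\<^sup>2)"
    unfolding c_def cinner_commute[of x y] complex_norm_square ..
  then have "Re (cinner x (- ((t *\<^sub>R c) *\<^sub>C y))) = - t * (cmod c)\<^sup>2"
    by (simp add: cinner_minus_right cinner_scaleC_right scaleR_conv_of_real mult.assoc)
  then show ?thesis
    using norm_add_square[of x "- ((t *\<^sub>R c) *\<^sub>C y)"] by (simp add: power_mult_distrib)
qed

lemma cinner_Cauchy_Schwarz: "cmod (cinner y x) \<le> norm y * norm (x::'a::complex_hilbert)"
proof (cases "y = 0")
  case True
  then show ?thesis
    using cinner_scaleR_left[of 0 0 x] by simp
next
  case False
  \<comment> \<open>The minimiser of the quadratic in t.\<close>
  define t where "t = 1 / (norm y)\<^sup>2"
  have t: "t * (norm y)\<^sup>2 = 1"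
    using False by (simp add: t_def)
  have "0 \<le> (norm x)\<^sup>2 - 2 * t * (cmod (cinner y x))\<^sup>2 + t * (t * (norm y)\<^sup>2) * (cmod (cinner y x))\<^sup>2"
    using norm_diff_scaleC_square[of x t y] zero_le_power2[of "norm (x - (t *\<^sub>R cinner y x) *\<^sub>C y)"]
    by (simp add: power2_eq_square mult_ac)
  then have "t * (cmod (cinner y x))\<^sup>2 \<le> (norm x)\<^sup>2"
    using t by simp
  then have "(cmod (cinner y x))\<^sup>2 \<le> (norm y * norm x)\<^sup>2"
    using False by (simp add: t_def field_simps power_mult_distrib)
  then show ?thesis
    by (rule power2_le_imp_le) simp
qed

lemma bounded_bilinear_cinner:
  "bounded_bilinear (cinner :: 'a::complex_hilbert \<Rightarrow> 'a \<Rightarrow> complex)"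
  by unfold_locales
    (auto simp: cinner_add_left cinner_add_right cinner_scaleR_left cinner_scaleR_right
      intro!: exI[of _ 1] cinner_Cauchy_Schwarz)

subsection \<open>Orthogonal projections\<close>

locale closed_complex_subspace =
  fixes S :: "'a::complex_hilbert set"
  assumes closed: "closed S"
    and zero: "0 \<in> S"
    and add: "x \<in> S \<Longrightarrow> y \<in> S \<Longrightarrow> x + y \<in> S"
    and scaleC: "x \<in> S \<Longrightarrow> z *\<^sub>C x \<in> S"
begin

lemma scaleR: "x \<in> S \<Longrightarrow> r *\<^sub>R x \<in> S"
  by (simp add: scaleR_scaleC scaleC)

lemma diff: "x \<in> S \<Longrightarrow> y \<in> S \<Longrightarrow> x - y \<in> S"
  using add[of x "(-1) *\<^sub>R y"] scaleR[of y "-1"] by simp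

text \<open>The midpoint of two nearly optimal points lies in \<open>S\<close>, so its squared
  distance is at least the infimum; the parallelogram law then forces the two points together, and a
  minimising sequence is Cauchy.\<close>

lemma closest_point_exists:
  "\<exists>s\<in>S. \<forall>s'\<in>S. norm (\<xi> - s) \<le> norm (\<xi> - s')"
proof -
  define d where "d = (INF s\<in>S. (norm (\<xi> - s))\<^sup>2)"
  have d_le: "d \<le> (norm (\<xi> - s))\<^sup>2" if "s \<in> S" for s
    unfolding d_def using that by (intro cINF_lower bdd_belowI2[of _ 0]) auto
  have "\<exists>s\<in>S. (norm (\<xi> - s))\<^sup>2 < d + 1 / real (Suc n)" for n
    using cInf_lessD[of "(\<lambda>s. (norm (\<xi> - s))\<^sup>2) ` S" "d + 1 / real (Suc n)"] zero
    by (auto simp: d_def)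
  then obtain s where s: "\<And>n. s n \<in> S" "\<And>n. (norm (\<xi> - s n))\<^sup>2 < d + 1 / real (Suc n)"
    by metis
  have dist: "(norm (s m - s n))\<^sup>2 \<le> 2 / real (Suc m) + 2 / real (Suc n)" for m n
  proof -
    have "(1/2) *\<^sub>R (s m + s n) \<in> S"
      by (intro scaleR add s)
    from d_le[OF this] have "4 * d \<le> (2 * norm (\<xi> - (1/2) *\<^sub>R (s m + s n)))\<^sup>2"
      by (simp add: power_mult_distrib)
    also have "2 * norm (\<xi> - (1/2) *\<^sub>R (s m + s n)) = norm (2 *\<^sub>R (\<xi> - (1/2) *\<^sub>R (s m + s n)))"
      by simp
    also have "2 *\<^sub>R (\<xi> - (1/2) *\<^sub>R (s m + s n)) = (\<xi> - s m) + (\<xi> - s n)"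
      by (simp add: algebra_simps scaleR_2)
    finally have "4 * d \<le> (norm ((\<xi> - s m) + (\<xi> - s n)))\<^sup>2" .
    then show ?thesis
      using parallelogram[of "\<xi> - s m" "\<xi> - s n"] s(2)[of m] s(2)[of n]
      by (simp add: norm_minus_commute)
  qed
  have "Cauchy s"
  proof (rule metric_CauchyI)
    fix e :: real assume e: "e > 0"
    obtain N where N: "4 / e\<^sup>2 < real N"
      using reals_Archimedean2 by blast
    then have "N > 0"
      using e by (metis divide_pos_pos of_nat_0_less_iff order.strict_trans zero_less_numeral zero_less_power)
    have "dist (s m) (s n) < e" if "m \<ge> N" "n \<ge> N" for m n
    proof -
      have "2 / real (Suc m) + 2 / real (Suc n) \<le> 2 / real N + 2 / real N"
        using that \<open>N > 0\<close> by (intro add_mono divide_left_mono) auto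
      also have "\<dots> < e\<^sup>2"
        using N e \<open>N > 0\<close> by (simp add: field_simps)
      finally have "(norm (s m - s n))\<^sup>2 < e\<^sup>2"
        using dist[of m n] by simp
      then show ?thesis
        using e power2_less_imp_less[of "norm (s m - s n)" e] by (simp add: dist_norm)
    qed
    then show "\<exists>M. \<forall>m\<ge>M. \<forall>n\<ge>M. dist (s m) (s n) < e"
      by blast
  qed
  then obtain l where l: "s \<longlonglongrightarrow> l"
    using Cauchy_convergent_iff convergent_def by blast
  have "l \<in> S"
    using closed s(1) l by (rule closed_sequentially)
  moreover have "(norm (\<xi> - l))\<^sup>2 \<le> d"
  proof (rule LIMSEQ_le)
    show "(\<lambda>n. (norm (\<xi> - s n))\<^sup>2) \<longlonglongrightarrow> (norm (\<xi> - l))\<^sup>2"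
      by (intro tendsto_intros l)
    show "(\<lambda>n. d + 1 / real (Suc n)) \<longlonglongrightarrow> d"
      using tendsto_add[OF tendsto_const[of d] LIMSEQ_inverse_real_of_nat]
      by (simp add: inverse_eq_divide)
  qed (use s(2) in \<open>auto intro: less_imp_le\<close>)
  ultimately show ?thesis
    using d_le by (metis order.trans power2_le_imp_le norm_ge_zero)
qed

lemma orthogonal_decomposition:
  "\<exists>s\<in>S. \<forall>\<eta>\<in>S. cinner \<eta> (\<xi> - s) = 0"
proof -
  obtain s where s: "s \<in> S" "\<And>s'. s' \<in> S \<Longrightarrow> norm (\<xi> - s) \<le> norm (\<xi> - s')"
    using closest_point_exists by blast
  have "cinner \<eta> (\<xi> - s) = 0" if \<eta>: "\<eta> \<in> S" for \<eta>
  proof (rule ccontr)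
    define c where "c = cinner \<eta> (\<xi> - s)"
    \<comment> \<open>The added 1 keeps the denominator positive and gives t |\<eta>|^2 <= 1, so
      that the quadratic term is at most half of the linear gain.\<close>
    define t where "t = 1 / ((norm \<eta>)\<^sup>2 + 1)"
    assume "cinner \<eta> (\<xi> - s) \<noteq> 0"
    then have c: "(cmod c)\<^sup>2 > 0"
      by (simp add: c_def)
    have "(norm \<eta>)\<^sup>2 + 1 > 0"
      by (simp add: add_nonneg_pos)
    then have t: "t > 0" "t * (norm \<eta>)\<^sup>2 \<le> 1"
      by (simp_all add: t_def)
    have "(norm (\<xi> - s))\<^sup>2 \<le> (norm (\<xi> - (s + (t *\<^sub>R c) *\<^sub>C \<eta>)))\<^sup>2"
      using s \<eta> by (intro power_mono) (auto intro: add scaleC)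
    also have "\<xi> - (s + (t *\<^sub>R c) *\<^sub>C \<eta>) = (\<xi> - s) - (t *\<^sub>R c) *\<^sub>C \<eta>"
      by simp
    finally have "2 * t * (cmod c)\<^sup>2 \<le> (t * (norm \<eta>)\<^sup>2) * (t * (cmod c)\<^sup>2)"
      using norm_diff_scaleC_square[of "\<xi> - s" t \<eta>] by (simp add: c_def power2_eq_square mult_ac)
    also have "\<dots> \<le> 1 * (t * (cmod c)\<^sup>2)"
      using t c by (intro mult_right_mono) auto
    finally show False
      using mult_pos_pos[OF t(1) c] by simp
  qed
  with s show ?thesis
    by blast
qed

lemma orthogonal_decomposition_unique:
  assumes "s \<in> S" "s' \<in> S" "\<forall>\<eta>\<in>S. cinner \<eta> (\<xi> - s) = 0" "\<forall>\<eta>\<in>S. cinner \<eta> (\<xi> - s') = 0"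
  shows "s = s'"
proof -
  have "cinner (s' - s) ((\<xi> - s) - (\<xi> - s')) = 0"
    using assms diff[of s' s] by (simp only: cinner_diff_right) simp
  then show ?thesis
    by simp
qed

text \<open>Linearity comes from uniqueness of the decomposition, the bound 1 from
  Pythagoras.\<close>

lemma orth_proj_exists:
  "\<exists>P. \<forall>\<xi>. blinfun_apply P \<xi> \<in> S \<and> (\<forall>\<eta>\<in>S. cinner \<eta> (\<xi> - blinfun_apply P \<xi>) = 0)"
proof -
  obtain p where p: "\<And>\<xi>. p \<xi> \<in> S" "\<And>\<xi> \<eta>. \<eta> \<in> S \<Longrightarrow> cinner \<eta> (\<xi> - p \<xi>) = 0"
    using orthogonal_decomposition by metis
  have eq: "p \<xi> = s" if "s \<in> S" "\<forall>\<eta>\<in>S. cinner \<eta> (\<xi> - s) = 0" for \<xi> s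
    using orthogonal_decomposition_unique[of "p \<xi>" s \<xi>] that p by blast
  have "bounded_linear p"
  proof (rule bounded_linear_intro)
    fix \<xi> \<zeta> :: 'a and r :: real
    have "cinner \<eta> ((\<xi> + \<zeta>) - (p \<xi> + p \<zeta>)) = 0" if "\<eta> \<in> S" for \<eta>
      using p(2)[OF that, of \<xi>] p(2)[OF that, of \<zeta>]
      by (simp add: cinner_diff_right cinner_add_right)
    then show "p (\<xi> + \<zeta>) = p \<xi> + p \<zeta>"
      by (intro eq add p) auto
    have "cinner \<eta> (r *\<^sub>R \<xi> - r *\<^sub>R p \<xi>) = 0" if "\<eta> \<in> S" for \<eta>
      using p(2)[OF that, of \<xi>] by (simp add: cinner_diff_right cinner_scaleR_right)
    then show "p (r *\<^sub>R \<xi>) = r *\<^sub>R p \<xi>"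
      by (intro eq scaleR p) auto
    have "(norm \<xi>)\<^sup>2 = (norm (p \<xi>))\<^sup>2 + (norm (\<xi> - p \<xi>))\<^sup>2"
      using norm_add_square[of "p \<xi>" "\<xi> - p \<xi>"] p by simp
    then have "(norm (p \<xi>))\<^sup>2 \<le> (norm \<xi>)\<^sup>2"
      by simp
    then show "norm (p \<xi>) \<le> norm \<xi> * 1"
      using power2_le_imp_le[of "norm (p \<xi>)" "norm \<xi>"] by simp
  qed
  then show ?thesis
    by (intro exI[of _ "Blinfun p"]) (simp add: bounded_linear_Blinfun_apply p)
qed

lemma orth_proj:
  shows orth_proj_in: "blinfun_apply (orth_proj S) \<xi> \<in> S"
    and orth_proj_orthogonal: "\<eta> \<in> S \<Longrightarrow> cinner \<eta> (\<xi> - blinfun_apply (orth_proj S) \<xi>) = 0"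
    and orth_proj_id: "\<zeta> \<in> S \<Longrightarrow> blinfun_apply (orth_proj S) \<zeta> = \<zeta>"
    and orth_proj_zero: "(\<And>\<eta>. \<eta> \<in> S \<Longrightarrow> cinner \<eta> \<zeta> = 0) \<Longrightarrow> blinfun_apply (orth_proj S) \<zeta> = 0"
proof -
  obtain P where P: "\<And>\<xi>. blinfun_apply P \<xi> \<in> S"
    "\<And>\<xi> \<eta>. \<eta> \<in> S \<Longrightarrow> cinner \<eta> (\<xi> - blinfun_apply P \<xi>) = 0"
    using orth_proj_exists by blast
  have P_id: "blinfun_apply P \<xi> = \<xi>" if "\<xi> \<in> S" for \<xi>
    using orthogonal_decomposition_unique[of "blinfun_apply P \<xi>" \<xi> \<xi>] that P by simp
  have P_zero: "blinfun_apply P \<xi> = 0" if "\<forall>\<eta>\<in>S. cinner \<eta> \<xi> = 0" for \<xi>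
    using orthogonal_decomposition_unique[of "blinfun_apply P \<xi>" 0 \<xi>] that P zero by simp
  \<comment> \<open>The two defining conditions fix an operator, every vector being the sum of one
    in \<open>S\<close> and one orthogonal to \<open>S\<close>.\<close>
  have "orth_proj S = P"
    unfolding orth_proj_def
  proof (rule the_equality)
    show "(\<forall>\<xi>\<in>S. blinfun_apply P \<xi> = \<xi>) \<and>
      (\<forall>\<xi>. (\<forall>\<eta>\<in>S. cinner \<eta> \<xi> = 0) \<longrightarrow> blinfun_apply P \<xi> = 0)"
      using P_id P_zero by blast
    fix Q assume Q: "(\<forall>\<xi>\<in>S. blinfun_apply Q \<xi> = \<xi>) \<and>
      (\<forall>\<xi>. (\<forall>\<eta>\<in>S. cinner \<eta> \<xi> = 0) \<longrightarrow> blinfun_apply Q \<xi> = 0)"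
    show "Q = P"
    proof (rule blinfun_eqI)
      fix \<xi>
      have "blinfun_apply Q (\<xi> - blinfun_apply P \<xi>) = 0"
        using Q P by blast
      then show "blinfun_apply Q \<xi> = blinfun_apply P \<xi>"
        using Q P by (simp add: blinfun.diff_right)
    qed
  qed
  with P P_id P_zero
  show "blinfun_apply (orth_proj S) \<xi> \<in> S"
    and "\<eta> \<in> S \<Longrightarrow> cinner \<eta> (\<xi> - blinfun_apply (orth_proj S) \<xi>) = 0"
    and "\<zeta> \<in> S \<Longrightarrow> blinfun_apply (orth_proj S) \<zeta> = \<zeta>"
    and "(\<And>\<eta>. \<eta> \<in> S \<Longrightarrow> cinner \<eta> \<zeta> = 0) \<Longrightarrow> blinfun_apply (orth_proj S) \<zeta> = 0"
    by blast+
qed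

end

text \<open>The map is Lipschitz on \<open>V\<close>, hence extends continuously to the closure;
  linearity and the bound are closed conditions and pass on by density.\<close>

lemma bounded_linear_extension:
  fixes \<phi> :: "'a::real_normed_vector \<Rightarrow> 'b::banach"
  assumes V: "subspace V" "closure V = UNIV"
    and add: "\<And>u v. u \<in> V \<Longrightarrow> v \<in> V \<Longrightarrow> \<phi> (u + v) = \<phi> u + \<phi> v"
    and scale: "\<And>r u. u \<in> V \<Longrightarrow> \<phi> (r *\<^sub>R u) = r *\<^sub>R \<phi> u"
    and bound: "\<And>u. u \<in> V \<Longrightarrow> norm (\<phi> u) \<le> B * norm u"
  shows "\<exists>T. \<forall>u\<in>V. blinfun_apply T u = \<phi> u"
proof -
  have dense: "P u" if "closed {u. P u}" "\<And>u. u \<in> V \<Longrightarrow> P u" for P u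
    using closure_minimal[of V "{u. P u}"] that V(2) by blast
  have "dist (\<phi> u) (\<phi> v) \<le> max B 0 * dist u v" if "u \<in> V" "v \<in> V" for u v
  proof -
    have "\<phi> (u - v) = \<phi> u - \<phi> v"
      using add[of "u - v" v] that V(1) by (simp add: subspace_diff)
    then have "dist (\<phi> u) (\<phi> v) \<le> B * dist u v"
      using bound[of "u - v"] that V(1) by (simp add: subspace_diff dist_norm)
    also have "\<dots> \<le> max B 0 * dist u v"
      by (intro mult_right_mono) auto
    finally show ?thesis .
  qed
  then have "(max B 0)-lipschitz_on V \<phi>"
    by (intro lipschitz_onI) auto
  then obtain g where g: "uniformly_continuous_on (closure V) g" "\<And>u. u \<in> V \<Longrightarrow> \<phi> u = g u"
    using uniformly_continuous_on_extension_on_closure[OF lipschitz_on_uniformly_continuous] by metis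
  then have cont: "continuous_on A g" for A
    using V(2) uniformly_continuous_imp_continuous continuous_on_subset by fastforce
  have cont': "continuous_on UNIV (\<lambda>u. g (k u))" if "continuous_on UNIV k" for k :: "'a \<Rightarrow> 'a"
    using continuous_on_compose[OF that cont] by (simp add: o_def)
  \<comment> \<open>Density is used in one variable at a time: first with \<open>v\<close> in
    \<open>V\<close>, then for all \<open>v\<close>.\<close>
  have add_V: "g (u + v) = g u + g v" if "v \<in> V" for u v
    by (rule dense[of "\<lambda>u. g (u + v) = g u + g v"])
      (use that add V(1) in \<open>auto intro!: closed_Collect_eq cont' continuous_intros cont simp: subspace_add simp flip: g(2)\<close>)
  have "g (u + v) = g u + g v" for u v
    by (rule dense[of "\<lambda>v. g (u + v) = g u + g v"])
      (auto intro!: closed_Collect_eq cont' continuous_intros cont simp: add_V)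
  moreover have "g (r *\<^sub>R u) = r *\<^sub>R g u" for r u
    by (rule dense[of "\<lambda>u. g (r *\<^sub>R u) = r *\<^sub>R g u"])
      (use scale V(1) in \<open>auto intro!: closed_Collect_eq cont' continuous_intros cont simp: subspace_scale simp flip: g(2)\<close>)
  moreover have "norm (g u) \<le> norm u * B" for u
    by (rule dense[of "\<lambda>u. norm (g u) \<le> norm u * B"])
      (use bound in \<open>auto intro!: closed_Collect_le continuous_intros cont simp: mult.commute simp flip: g(2)\<close>)
  ultimately have "bounded_linear g"
    by (rule bounded_linear_intro)
  then show ?thesis
    using g(2) by (intro exI[of _ "Blinfun g"]) (simp add: bounded_linear_Blinfun_apply)
qed

locale quantum_su2 =
  fixes q :: real and G :: "('b::cstar_algebra, 'h::complex_hilbert) su2"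
  assumes q_pos: "0 < q" and q_less_1: "q < 1" and quantum_SU2: "quantum_SU2 q G"
begin

section \<open>The GNS representation\<close>

abbreviation "gns \<equiv> gns_vec G"
abbreviation "rep \<equiv> gns_rep G"

lemma haar_add: "haar G (x + y) = haar G x + haar G y"
  and haar_scaleC: "haar G (z *\<^sub>C x) = z * haar G x"
  using quantum_SU2
  by (auto simp: quantum_SU2_def haar_spec_def Let_def complex_linear_on_def scaleC_complex_def)

lemma haar_scaleR: "haar G (r *\<^sub>R x) = of_real r * haar G x"
  by (simp add: scaleR_scaleC[of r x] haar_scaleC)

lemma gns_add: "gns (x + y) = gns x + gns y"
  and gns_scaleC: "gns (z *\<^sub>C x) = z *\<^sub>C gns x"
  and cinner_gns: "cinner (gns x) (gns y) = haar G (star x * y)"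
  and gns_dense: "closure (range gns) = UNIV"
  using quantum_SU2 by (auto simp: quantum_SU2_def gns_spec_def complex_linear_on_def)

lemma gns_scaleR: "gns (r *\<^sub>R x) = r *\<^sub>R gns x"
  by (simp add: scaleR_scaleC gns_scaleC)

lemma gns_zero [simp]: "gns 0 = 0"
  using gns_scaleR[of 0 0] by simp

lemma gns_diff: "gns (x - y) = gns x - gns y"
  using gns_add[of "x - y" y] by simp

lemma haar_norm_gns: "haar G (star x * x) = of_real ((norm (gns x))\<^sup>2)"
  by (simp add: cinner_norm flip: cinner_gns)

text \<open>For c > |x| put b = x* x / c^2 and 1 - b = s^2. Then |gns (s y)|^2 >= 0 says |gns (x y)|
  <= c |gns y|. The root needs |b| < 1 strictly, so c = |x| is reached only in the limit.\<close>

lemma norm_gns_mult: "norm (gns (x * y)) \<le> norm x * norm (gns y)"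
proof -
  have le: "norm (gns (x * y)) \<le> c * norm (gns y)" if c: "norm x < c" for c
  proof -
    have "c > 0"
      using c norm_ge_zero[of x] by linarith
    define b where "b = (1 / c\<^sup>2) *\<^sub>R (star x * x)"
    have "norm b = (norm x / c)\<^sup>2"
      by (simp add: b_def cstar_identity power_divide)
    also have "\<dots> < 1"
      using c \<open>c > 0\<close> by (simp add: power_less_one_iff)
    finally have "norm b < 1" .
    moreover have "star b = b"
      by (simp add: b_def star_scaleR star_mult star_star)
    ultimately obtain s where s: "star s = s" "s * s = 1 - b"
      using cstar_sqrt_one_minus by blast
    have "star (s * y) * (s * y) = star y * (s * s) * y"
      by (simp add: star_mult s(1) mult.assoc)
    also have "\<dots> = star y * y + (- 1 / c\<^sup>2) *\<^sub>R (star (x * y) * (x * y))"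
      unfolding s(2) by (simp add: b_def algebra_simps star_mult)
    finally have "haar G (star (s * y) * (s * y))
      = haar G (star y * y) + of_real (- 1 / c\<^sup>2) * haar G (star (x * y) * (x * y))"
      by (simp only: haar_add haar_scaleR)
    then have "complex_of_real ((norm (gns (s * y)))\<^sup>2)
      = complex_of_real ((norm (gns y))\<^sup>2 + (- 1 / c\<^sup>2) * (norm (gns (x * y)))\<^sup>2)"
      unfolding haar_norm_gns by simp
    then have "(norm (gns (s * y)))\<^sup>2 = (norm (gns y))\<^sup>2 - (norm (gns (x * y)))\<^sup>2 / c\<^sup>2"
      by (simp only: of_real_eq_iff) simp
    then have "(norm (gns (x * y)))\<^sup>2 / c\<^sup>2 \<le> (norm (gns y))\<^sup>2"
      using zero_le_power2[of "norm (gns (s * y))"] by linarith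
    then have "(norm (gns (x * y)))\<^sup>2 \<le> (c * norm (gns y))\<^sup>2"
      using \<open>c > 0\<close> by (simp add: divide_le_eq power_mult_distrib mult.commute)
    then show ?thesis
      using \<open>c > 0\<close> by (intro power2_le_imp_le[of "norm (gns (x * y))"]) auto
  qed
  show ?thesis
  proof (cases "norm (gns y) = 0")
    case True
    then show ?thesis
      using le[of "norm x + 1"] by simp
  next
    case False
    then have pos: "norm (gns y) > 0"
      by simp
    have "norm (gns (x * y)) / norm (gns y) \<le> norm x"
    proof (rule dense_ge)
      fix c assume "norm x < c"
      then show "norm (gns (x * y)) / norm (gns y) \<le> c"
        using le[of c] pos by (simp add: divide_le_eq)
    qed
    then show ?thesis
      using pos by (simp add: divide_le_eq)
  qed
qed

lemma gns_induct: "closed {\<xi>. P \<xi>} \<Longrightarrow> (\<And>y. P (gns y)) \<Longrightarrow> P \<xi>"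
  using closure_minimal[of "range gns" "{\<xi>. P \<xi>}"] gns_dense by blast

lemma blinfun_eq_gns:
  fixes S T :: "'h \<Rightarrow>\<^sub>L 'h"
  assumes "\<And>y. blinfun_apply S (gns y) = blinfun_apply T (gns y)"
  shows "S = T"
proof (rule blinfun_eqI)
  fix \<xi>
  show "blinfun_apply S \<xi> = blinfun_apply T \<xi>"
    by (rule gns_induct[of "\<lambda>\<xi>. blinfun_apply S \<xi> = blinfun_apply T \<xi>"])
      (auto intro!: closed_Collect_eq continuous_intros assms)
qed

lemma rep_gns: "blinfun_apply (rep x) (gns y) = gns (x * y)"
proof -
  have "subspace (range gns)"
    unfolding subspace_def by (auto simp flip: gns_add gns_scaleR intro: range_eqI[of _ _ 0])
  \<comment> \<open>\<open>gns_rep\<close> is a definite description, so an operator has to be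
    produced first. By \<open>norm_gns_mult\<close>, two preimages of a vector under
    \<open>gns\<close> still agree after multiplication by \<open>x\<close>, so the choice made here
    is harmless.\<close>
  moreover define \<phi> where "\<phi> v = gns (x * (SOME y. gns y = v))" for v
  have \<phi>: "\<phi> (gns y) = gns (x * y)" for y
  proof -
    have "gns (SOME y'. gns y' = gns y) = gns y"
      by (rule someI) (rule refl)
    then have "gns ((SOME y'. gns y' = gns y) - y) = 0"
      by (simp add: gns_diff)
    then have "gns (x * ((SOME y'. gns y' = gns y) - y)) = 0"
      using norm_gns_mult[of x "(SOME y'. gns y' = gns y) - y"] by simp
    then show ?thesis
      by (simp add: \<phi>_def right_diff_distrib gns_diff)
  qed
  have "\<phi> (u + v) = \<phi> u + \<phi> v" if "u \<in> range gns" "v \<in> range gns" for u v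
    using that by (auto simp: \<phi> distrib_left gns_add simp flip: gns_add)
  moreover have "\<phi> (r *\<^sub>R u) = r *\<^sub>R \<phi> u" if "u \<in> range gns" for r u
    using that by (auto simp: \<phi> gns_scaleR simp flip: gns_scaleR)
  moreover have "norm (\<phi> u) \<le> norm x * norm u" if "u \<in> range gns" for u
    using that by (auto simp: \<phi> norm_gns_mult)
  ultimately obtain T where T: "\<forall>u\<in>range gns. blinfun_apply T u = \<phi> u"
    using bounded_linear_extension[OF _ gns_dense, of \<phi> "norm x"] by metis
  have "rep x = T"
    unfolding gns_rep_def
    by (rule the_equality) (use T \<phi> in \<open>auto intro!: blinfun_eq_gns\<close>)
  with T \<phi> show ?thesis
    by simp
qed

lemma rep_add: "rep (x + y) = rep x + rep y"
  by (rule blinfun_eq_gns) (simp add: rep_gns blinfun.add_left distrib_right gns_add)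

lemma rep_scaleR: "rep (r *\<^sub>R x) = r *\<^sub>R rep x"
  by (rule blinfun_eq_gns) (simp add: rep_gns blinfun.scaleR_left gns_scaleR)

lemma rep_mult: "rep (x * y) = rep x o\<^sub>L rep y"
  by (rule blinfun_eq_gns) (simp add: rep_gns mult.assoc)

lemma rep_one: "rep 1 = id_blinfun"
  by (rule blinfun_eq_gns) (simp add: rep_gns)

lemma rep_zero [simp]: "rep 0 = 0"
  using rep_scaleR[of 0 0] by simp

lemma rep_diff: "rep (x - y) = rep x - rep y"
  using rep_add[of "x - y" y] by simp

lemma norm_rep_le: "norm (rep x) \<le> norm x"
proof (rule norm_blinfun_bound)
  fix \<xi>
  show "norm (blinfun_apply (rep x) \<xi>) \<le> norm x * norm \<xi>"
    by (rule gns_induct[of "\<lambda>\<xi>. norm (blinfun_apply (rep x) \<xi>) \<le> norm x * norm \<xi>"])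
      (auto intro!: closed_Collect_le continuous_intros simp: rep_gns norm_gns_mult)
qed simp

lemma tendsto_rep: "X \<longlonglongrightarrow> x \<Longrightarrow> (\<lambda>k. rep (X k)) \<longlonglongrightarrow> rep x"
proof -
  have "bounded_linear rep"
    by (rule bounded_linear_intro[of _ 1]) (simp_all add: rep_add rep_scaleR norm_rep_le)
  then show "X \<longlonglongrightarrow> x \<Longrightarrow> (\<lambda>k. rep (X k)) \<longlonglongrightarrow> rep x"
    by (rule bounded_linear.tendsto)
qed

lemma continuous_cinner:
  "continuous_on A k \<Longrightarrow> continuous_on A l \<Longrightarrow> continuous_on A (\<lambda>u. cinner (k u) (l u :: 'h))"
  by (rule bounded_bilinear.continuous_on[OF bounded_bilinear_cinner])

text \<open>Clear on the dense range of \<open>gns\<close>, then extended by continuity in each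
  variable. It lets \<open>rep_P\<close> pass from an invariant subspace to its complement.\<close>

lemma cinner_rep: "cinner \<xi> (blinfun_apply (rep x) \<eta>) = cinner (blinfun_apply (rep (star x)) \<xi>) \<eta>"
proof -
  have *: "cinner (gns y) (blinfun_apply (rep x) \<eta>) = cinner (blinfun_apply (rep (star x)) (gns y)) \<eta>" for y
    by (rule gns_induct[of "\<lambda>\<eta>. cinner (gns y) (blinfun_apply (rep x) \<eta>)
          = cinner (blinfun_apply (rep (star x)) (gns y)) \<eta>"])
      (auto intro!: closed_Collect_eq continuous_cinner continuous_intros
        simp: rep_gns cinner_gns star_mult star_star mult.assoc)
  show ?thesis
    by (rule gns_induct[of "\<lambda>\<xi>. cinner \<xi> (blinfun_apply (rep x) \<eta>)
          = cinner (blinfun_apply (rep (star x)) \<xi>) \<eta>"])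
      (auto intro!: closed_Collect_eq continuous_cinner continuous_intros simp: *)
qed

end

section \<open>The coordinate algebra\<close>

lemma nceval_superset:
  assumes "finite S" "Poly_Mapping.keys p \<subseteq> S"
  shows "nceval a c p = (\<Sum>w\<in>S. Poly_Mapping.lookup p w *\<^sub>C word_val a c w)"
  unfolding nceval_def using assms by (intro sum.mono_neutral_left) (auto simp: in_keys_iff)

lemma nceval_add: "nceval a c (p + p') = nceval a c p + nceval a c p'"
proof -
  let ?S = "Poly_Mapping.keys p \<union> Poly_Mapping.keys p'"
  have "nceval a c (p + p') = (\<Sum>w\<in>?S. Poly_Mapping.lookup (p + p') w *\<^sub>C word_val a c w)"
    by (rule nceval_superset) (simp_all add: keys_add)
  also have "\<dots> = (\<Sum>w\<in>?S. Poly_Mapping.lookup p w *\<^sub>C word_val a c w)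
      + (\<Sum>w\<in>?S. Poly_Mapping.lookup p' w *\<^sub>C word_val a c w)"
    by (simp add: lookup_add scaleC_add_left sum.distrib)
  also have "\<dots> = nceval a c p + nceval a c p'"
    by (simp add: nceval_superset[of ?S])
  finally show ?thesis .
qed

lemma nceval_zero [simp]: "nceval a c 0 = 0"
  by (simp add: nceval_def)

lemma nceval_diff: "nceval a c (p - p') = nceval a c p - nceval a c p'"
  using nceval_add[of a c "p - p'" p'] by simp

lemma nceval_sum: "nceval a c (\<Sum>i\<in>S. p i) = (\<Sum>i\<in>S. nceval a c (p i))"
  by (induction S rule: infinite_finite_induct) (auto simp: nceval_add)

lemma nceval_single: "nceval a c (Poly_Mapping.single w z) = z *\<^sub>C word_val a c w"
  by (simp add: nceval_def)

lemma nceval_one: "nceval a c 1 = 1"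
proof -
  have "nceval a c 1 = word_val a c 0"
    using nceval_single[of a c 0 1] by simp
  then show ?thesis
    by (simp add: word_val_def zero_ncword_def)
qed

lemma nceval_ncmono: "nceval a c (ncmono ls) = prod_list (map (letter_val a c) ls)"
  by (simp add: ncmono_def nceval_single word_val_def)

lemma nceval_ncconst_mult:
  "nceval a c (ncconst z * ncmono ls) = z *\<^sub>C prod_list (map (letter_val a c) ls)"
  by (simp add: ncconst_def ncmono_def mult_single nceval_single word_val_def)

lemma mult_power_scaled:
  fixes x y :: "'a::real_algebra_1"
  assumes "x * y = r *\<^sub>R (y * x)"
  shows "x * y ^ n = r ^ n *\<^sub>R (y ^ n * x)"
proof (induction n)
  case (Suc n)
  have "x * y ^ Suc n = (x * y) * y ^ n"
    by (simp add: mult.assoc)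
  also have "\<dots> = r *\<^sub>R (y * (x * y ^ n))"
    by (simp add: assms mult.assoc)
  finally show ?case
    by (simp add: Suc.IH mult.assoc)
qed simp

lemma power_mult_scaled:
  fixes x y :: "'a::real_algebra_1"
  assumes "x * y = r *\<^sub>R (y * x)"
  shows "x ^ n * y = r ^ n *\<^sub>R (y * x ^ n)"
proof (induction n)
  case (Suc n)
  have "x ^ Suc n * y = x * (x ^ n * y)"
    by (simp add: mult.assoc)
  also have "\<dots> = r ^ n *\<^sub>R ((x * y) * x ^ n)"
    by (simp add: Suc.IH mult.assoc)
  finally show ?case
    by (simp add: assms mult.assoc mult.commute)
qed simp

context quantum_su2
begin

abbreviation "\<alpha> \<equiv> gen_a G"
abbreviation "\<gamma> \<equiv> gen_c G"
abbreviation "\<alpha>s \<equiv> star (gen_a G)"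
abbreviation "\<gamma>s \<equiv> star (gen_c G)"
abbreviation "word \<equiv> word_val \<alpha> \<gamma>"
abbreviation "K \<equiv> act_K G"
abbreviation "F \<equiv> act_F G"
abbreviation "L \<equiv> line_bundle G"

lemma qpar [simp]: "qpar G = q"
  using quantum_SU2 by (simp add: quantum_SU2_def)

lemma q_neq_0 [simp]: "q \<noteq> 0"
  using q_pos by simp

lemma nceval_relator: "r \<in> relators q \<Longrightarrow> nceval \<alpha> \<gamma> r = 0"
  using quantum_SU2 relation_ideal.relator[of r q] by (simp add: quantum_SU2_def presented_def)

lemma \<alpha>\<gamma>: "\<alpha> * \<gamma> = q *\<^sub>R (\<gamma> * \<alpha>)"
  and \<alpha>\<gamma>s: "\<alpha> * \<gamma>s = q *\<^sub>R (\<gamma>s * \<alpha>)"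
  and \<gamma>s\<gamma>: "\<gamma>s * \<gamma> = \<gamma> * \<gamma>s"
  and \<alpha>s\<alpha>: "\<alpha>s * \<alpha> = 1 - \<gamma> * \<gamma>s"
  and \<alpha>\<alpha>s: "\<alpha> * \<alpha>s = 1 - q\<^sup>2 *\<^sub>R (\<gamma> * \<gamma>s)"
proof -
  have "nceval \<alpha> \<gamma> (ncmono [LA, LC] - ncconst (of_real q) * ncmono [LC, LA]) = 0"
    "nceval \<alpha> \<gamma> (ncmono [LA, LCs] - ncconst (of_real q) * ncmono [LCs, LA]) = 0"
    "nceval \<alpha> \<gamma> (ncmono [LC, LCs] - ncmono [LCs, LC]) = 0"
    "nceval \<alpha> \<gamma> (ncmono [LAs, LA] + ncmono [LCs, LC] - 1) = 0"
    "nceval \<alpha> \<gamma> (ncmono [LA, LAs] + ncconst (of_real (q\<^sup>2)) * ncmono [LC, LCs] - 1) = 0"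
    by (rule nceval_relator; simp add: relators_def)+
  then show "\<alpha> * \<gamma> = q *\<^sub>R (\<gamma> * \<alpha>)" "\<alpha> * \<gamma>s = q *\<^sub>R (\<gamma>s * \<alpha>)" and *: "\<gamma>s * \<gamma> = \<gamma> * \<gamma>s"
    and "\<alpha>s * \<alpha> = 1 - \<gamma> * \<gamma>s" "\<alpha> * \<alpha>s = 1 - q\<^sup>2 *\<^sub>R (\<gamma> * \<gamma>s)"
    by (simp_all add: nceval_add nceval_diff nceval_one nceval_ncmono nceval_ncconst_mult
        scaleC_of_real eq_diff_eq del: of_real_power)
qed

lemma \<gamma>\<alpha>: "\<gamma> * \<alpha> = (1 / q) *\<^sub>R (\<alpha> * \<gamma>)"
  by (simp add: \<alpha>\<gamma>)

lemma \<gamma>s\<alpha>: "\<gamma>s * \<alpha> = (1 / q) *\<^sub>R (\<alpha> * \<gamma>s)"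
  by (simp add: \<alpha>\<gamma>s)

lemma \<gamma>s\<alpha>s: "\<gamma>s * \<alpha>s = q *\<^sub>R (\<alpha>s * \<gamma>s)"
  using arg_cong[OF \<alpha>\<gamma>, of star] by (simp add: star_mult star_scaleR)

lemma \<gamma>\<alpha>s: "\<gamma> * \<alpha>s = q *\<^sub>R (\<alpha>s * \<gamma>)"
  using arg_cong[OF \<alpha>\<gamma>s, of star] by (simp add: star_mult star_scaleR star_star)

lemma \<alpha>s\<gamma>: "\<alpha>s * \<gamma> = (1 / q) *\<^sub>R (\<gamma> * \<alpha>s)"
  by (simp add: \<gamma>\<alpha>s)

lemma \<gamma>s_power_\<gamma>: "\<gamma>s * \<gamma> ^ j = \<gamma> ^ j * \<gamma>s"
  using mult_power_scaled[of \<gamma>s \<gamma> 1 j] by (simp add: \<gamma>s\<gamma>)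

subsection \<open>Polynomials in the generators\<close>

lemma word_in_ASU: "word w \<in> ASU G"
  unfolding ASU_def using nceval_single[of \<alpha> \<gamma> w 1] by (metis rangeI scaleC_one)

lemma ASU_add: "x \<in> ASU G \<Longrightarrow> y \<in> ASU G \<Longrightarrow> x + y \<in> ASU G"
  unfolding ASU_def by (auto simp flip: nceval_add)

lemma ASU_scaleC: "x \<in> ASU G \<Longrightarrow> z *\<^sub>C x \<in> ASU G"
proof -
  assume "x \<in> ASU G"
  then obtain p where x: "x = nceval \<alpha> \<gamma> p"
    by (auto simp: ASU_def)
  have "z *\<^sub>C x
    = nceval \<alpha> \<gamma> (\<Sum>w\<in>Poly_Mapping.keys p. Poly_Mapping.single w (z * Poly_Mapping.lookup p w))"
    unfolding nceval_sum nceval_single x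
    by (simp add: nceval_def scaleC_sum_right scaleC_scaleC)
  then show ?thesis
    unfolding ASU_def by blast
qed

lemma ASU_scaleR: "x \<in> ASU G \<Longrightarrow> r *\<^sub>R x \<in> ASU G"
  by (simp add: scaleR_scaleC ASU_scaleC)

lemma ASU_zero: "0 \<in> ASU G"
  unfolding ASU_def by (rule range_eqI[of _ _ 0]) simp

lemma ASU_sum: "(\<And>i. i \<in> S \<Longrightarrow> x i \<in> ASU G) \<Longrightarrow> (\<Sum>i\<in>S. x i) \<in> ASU G"
  by (induction S rule: infinite_finite_induct) (auto intro: ASU_add ASU_zero)

lemma ASU_induct [consumes 1, case_names word add scaleC]:
  assumes "x \<in> ASU G"
    and word: "\<And>w. P (word w)"
    and add: "\<And>x y. x \<in> ASU G \<Longrightarrow> y \<in> ASU G \<Longrightarrow> P x \<Longrightarrow> P y \<Longrightarrow> P (x + y)"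
    and scaleC: "\<And>z x. x \<in> ASU G \<Longrightarrow> P x \<Longrightarrow> P (z *\<^sub>C x)"
  shows "P x"
proof -
  obtain p where x: "x = nceval \<alpha> \<gamma> p"
    using assms(1) by (auto simp: ASU_def)
  have "P 0"
    using scaleC[OF word_in_ASU word, of 0] by simp
  have sum: "P (\<Sum>w\<in>S. u w *\<^sub>C word w)" for S u
    by (induction S rule: infinite_finite_induct)
      (use \<open>P 0\<close> in \<open>auto intro!: add scaleC word word_in_ASU ASU_scaleC ASU_sum\<close>)
  show ?thesis
    unfolding x nceval_def by (rule sum)
qed

lemma word_NCW_Nil: "word (NCW []) = 1"
  and word_NCW_Cons: "word (NCW (l # ls)) = letter_val \<alpha> \<gamma> l * word (NCW ls)"
  and word_NCW_append: "word (NCW (ls @ ls')) = word (NCW ls) * word (NCW ls')"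
  by (simp_all add: word_val_def)

lemma word_induct [case_names Nil Cons]:
  assumes "P (NCW [])" "\<And>l ls. P (NCW ls) \<Longrightarrow> P (NCW (l # ls))"
  shows "P w"
proof (cases w)
  case (NCW ls)
  have "P (NCW ls)"
    by (induction ls) (auto intro: assms)
  then show ?thesis
    by (simp add: NCW)
qed

lemma letter_in_ASU: "letter_val \<alpha> \<gamma> l \<in> ASU G"
  using word_in_ASU[of "NCW [l]"] by (simp add: word_val_def)

lemma gens_in_ASU: "\<alpha> \<in> ASU G" "\<gamma> \<in> ASU G" "\<alpha>s \<in> ASU G" "\<gamma>s \<in> ASU G"
  using letter_in_ASU[of LA] letter_in_ASU[of LC] letter_in_ASU[of LAs] letter_in_ASU[of LCs]
  by simp_all

lemma ASU_one: "1 \<in> ASU G"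
  using word_in_ASU[of "NCW []"] by (simp add: word_NCW_Nil)

lemma ASU_mult:
  assumes "x \<in> ASU G" "y \<in> ASU G"
  shows "x * y \<in> ASU G"
  using assms(1)
proof (induction rule: ASU_induct)
  case (word w)
  from assms(2) show ?case
  proof (induction rule: ASU_induct)
    case (word w')
    show ?case
      using word_in_ASU[of "NCW (letters w @ letters w')"] by (simp add: word_NCW_append)
  qed (auto simp: distrib_left mult_scaleC_right intro: ASU_add ASU_scaleC)
qed (auto simp: distrib_right mult_scaleC_left intro: ASU_add ASU_scaleC)

lemma ASU_star: "x \<in> ASU G \<Longrightarrow> star x \<in> ASU G"
proof (induction rule: ASU_induct)
  case (word w)
  show ?case
  proof (induction w rule: word_induct)
    case (Cons l ls)
    have "star (letter_val \<alpha> \<gamma> l) \<in> ASU G"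
      by (cases l) (auto simp: star_star gens_in_ASU)
    with Cons show ?case
      by (auto simp: word_NCW_Cons star_mult intro: ASU_mult)
  qed (simp add: word_NCW_Nil ASU_one)
qed (auto simp: star_add star_scaleC intro: ASU_add ASU_scaleC)

subsection \<open>The grading by K\<close>

text \<open>The eigenvalue of \<open>K\<close> on degree n. As a homomorphism in n it turns the
  twists in the Leibniz rule into arithmetic of degrees.\<close>

definition qh :: "int \<Rightarrow> real" where
  "qh n = q powr (of_int n / 2)"

lemma qh_pos [simp]: "qh n > 0"
  using q_pos by (simp add: qh_def)

lemma qh_neq_0 [simp]: "qh n \<noteq> 0"
  using qh_pos[of n] by linarith

lemma qh_0 [simp]: "qh 0 = 1"
  by (simp add: qh_def)

lemma qh_add: "qh (m + n) = qh m * qh n"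
  by (simp add: qh_def add_divide_distrib powr_add)

lemma qh_inverse [simp]: "qh n * qh (- n) = 1" "qh (- n) * qh n = 1"
  by (simp_all flip: qh_add)

lemma qh_minus_2: "qh (- 2) = 1 / q"
  using q_pos by (simp add: qh_def powr_minus_divide)

lemma qh_inj: "qh m = qh n \<longleftrightarrow> m = n"
  using q_pos q_less_1 by (simp add: qh_def powr_inj)

lemma
  shows K_in_ASU: "x \<in> ASU G \<Longrightarrow> K x \<in> ASU G"
    and K_inj: "inj_on K (ASU G)"
    and K_add: "x \<in> ASU G \<Longrightarrow> y \<in> ASU G \<Longrightarrow> K (x + y) = K x + K y"
    and K_scaleC: "x \<in> ASU G \<Longrightarrow> K (z *\<^sub>C x) = z *\<^sub>C K x"
    and K_one: "K 1 = 1"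
    and K_mult: "x \<in> ASU G \<Longrightarrow> y \<in> ASU G \<Longrightarrow> K (x * y) = K x * K y"
    and K_gens: "K \<alpha> = qh (- 1) *\<^sub>R \<alpha>" "K \<gamma> = qh (- 1) *\<^sub>R \<gamma>" "K \<alpha>s = qh 1 *\<^sub>R \<alpha>s" "K \<gamma>s = qh 1 *\<^sub>R \<gamma>s"
  using quantum_SU2
  by (auto simp: quantum_SU2_def K_spec_def Let_def complex_linear_on_def qh_def bij_betw_def)

lemma K_scaleR: "x \<in> ASU G \<Longrightarrow> K (r *\<^sub>R x) = r *\<^sub>R K x"
  by (simp add: scaleR_scaleC K_scaleC)

lemma K_zero: "K 0 = 0"
  using K_scaleR[OF ASU_zero, of 0] by simp

lemma K_sum: "(\<And>i. i \<in> S \<Longrightarrow> x i \<in> ASU G) \<Longrightarrow> K (\<Sum>i\<in>S. x i) = (\<Sum>i\<in>S. K (x i))"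
  by (induction S rule: infinite_finite_induct) (auto simp: K_add ASU_sum K_zero)

lemma L_iff: "x \<in> L n \<longleftrightarrow> x \<in> ASU G \<and> K x = qh n *\<^sub>R x"
  by (simp add: line_bundle_def qh_def)

lemma L_in_ASU: "x \<in> L n \<Longrightarrow> x \<in> ASU G"
  by (simp add: L_iff)

lemma L_zero: "0 \<in> L n"
  by (simp add: L_iff ASU_zero K_zero)

lemma L_one: "1 \<in> L 0"
  by (simp add: L_iff ASU_one K_one)

lemma L_add: "x \<in> L n \<Longrightarrow> y \<in> L n \<Longrightarrow> x + y \<in> L n"
  by (simp add: L_iff ASU_add K_add scaleR_add_right)

lemma L_scaleC: "x \<in> L n \<Longrightarrow> z *\<^sub>C x \<in> L n"
  by (simp add: L_iff ASU_scaleC K_scaleC scaleC_scaleR)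

lemma L_scaleR: "x \<in> L n \<Longrightarrow> r *\<^sub>R x \<in> L n"
  by (simp add: scaleR_scaleC L_scaleC)

lemma L_diff: "x \<in> L n \<Longrightarrow> y \<in> L n \<Longrightarrow> x - y \<in> L n"
  using L_add[of x n "(-1) *\<^sub>R y"] L_scaleR[of y n "-1"] by simp

lemma L_sum: "(\<And>i. i \<in> S \<Longrightarrow> x i \<in> L n) \<Longrightarrow> (\<Sum>i\<in>S. x i) \<in> L n"
  by (induction S rule: infinite_finite_induct) (auto intro: L_add L_zero)

lemma L_mult: "x \<in> L m \<Longrightarrow> y \<in> L n \<Longrightarrow> x * y \<in> L (m + n)"
  by (simp add: L_iff ASU_mult K_mult qh_add mult.commute)

lemma L_mult': "x \<in> L m \<Longrightarrow> y \<in> L n \<Longrightarrow> k = m + n \<Longrightarrow> x * y \<in> L k"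
  using L_mult by simp

lemma L_power:
  assumes "x \<in> L m"
  shows "x ^ k \<in> L (int k * m)"
proof (induction k)
  case (Suc k)
  show ?case
    unfolding power_Suc by (rule L_mult'[OF assms Suc.IH]) (simp add: algebra_simps)
qed (simp add: L_one)

lemma gens_in_L: "\<alpha> \<in> L (- 1)" "\<gamma> \<in> L (- 1)" "\<alpha>s \<in> L 1" "\<gamma>s \<in> L 1"
  by (simp_all add: L_iff gens_in_ASU K_gens)

lemma powers_in_L:
  "\<alpha> ^ i \<in> L (- int i)" "\<gamma> ^ i \<in> L (- int i)" "\<alpha>s ^ i \<in> L (int i)" "\<gamma>s ^ i \<in> L (int i)"
  using gens_in_L[THEN L_power, of i] by simp_all

fun letter_weight :: "letter \<Rightarrow> int" where
  "letter_weight LA = - 1"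
| "letter_weight LAs = 1"
| "letter_weight LC = - 1"
| "letter_weight LCs = 1"

definition word_weight :: "ncword \<Rightarrow> int" where
  "word_weight w = sum_list (map letter_weight (letters w))"

lemma letter_in_L: "letter_val \<alpha> \<gamma> l \<in> L (letter_weight l)"
  by (cases l) (simp_all add: gens_in_L)

lemma word_weight_NCW [simp]:
  "word_weight (NCW []) = 0" "word_weight (NCW (l # ls)) = letter_weight l + word_weight (NCW ls)"
  by (simp_all add: word_weight_def)

lemma word_in_L: "word w \<in> L (word_weight w)"
  by (induction w rule: word_induct)
    (auto simp: word_NCW_Nil word_NCW_Cons L_one intro: L_mult letter_in_L)

lemma star_K: "x \<in> ASU G \<Longrightarrow> K (star (K x)) = star x"
proof (induction rule: ASU_induct)
  case (word w)
  have "star (word w) \<in> L (- word_weight w)"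
  proof (induction w rule: word_induct)
    case (Cons l ls)
    have "star (letter_val \<alpha> \<gamma> l) \<in> L (- letter_weight l)"
      by (cases l) (auto simp: star_star gens_in_L)
    with Cons show ?case
      by (auto simp: word_NCW_Cons star_mult intro: L_mult')
  qed (simp add: word_NCW_Nil L_one)
  then show ?case
    using word_in_L[of w] by (simp add: L_iff star_scaleR K_scaleR)
qed (simp_all add: K_add K_scaleC star_add star_scaleC ASU_star K_in_ASU)

lemma L_star: "x \<in> L n \<Longrightarrow> star x \<in> L (- n)"
proof -
  assume x: "x \<in> L n"
  then have "qh n *\<^sub>R K (star x) = star x"
    using star_K[of x] by (simp add: L_iff star_scaleR K_scaleR ASU_star)
  then have "K (star x) = qh (- n) *\<^sub>R star x"
    by (metis qh_inverse(2) scaleR_one scaleR_scaleR)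
  then show ?thesis
    using x by (simp add: L_iff ASU_star)
qed

lemma Kinv_L: "x \<in> L n \<Longrightarrow> act_Kinv G x = qh (- n) *\<^sub>R x"
proof -
  assume "x \<in> L n"
  then have "K (qh (- n) *\<^sub>R x) = x" "qh (- n) *\<^sub>R x \<in> ASU G"
    by (simp_all add: L_iff K_scaleR ASU_scaleR)
  then show ?thesis
    unfolding act_Kinv_def using inv_into_f_f[OF K_inj] by metis
qed

text \<open>Eigenvectors for distinct eigenvalues: applying \<open>K\<close> and subtracting
  \<open>qh k\<close> times the relation removes the component \<open>y k\<close>, and
  \<open>qh\<close> is injective.\<close>

lemma L_independent:
  assumes "finite N" "\<And>m. m \<in> N \<Longrightarrow> y m \<in> L m" "(\<Sum>m\<in>N. y m) = 0" "m \<in> N"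
  shows "y m = 0"
  using assms
proof (induction N arbitrary: y m rule: finite_induct)
  case (insert k N)
  have sum: "y k + (\<Sum>m\<in>N. y m) = 0"
    using insert by simp
  have "y k \<in> ASU G" "\<And>m. m \<in> N \<Longrightarrow> y m \<in> ASU G"
    using insert.prems(1) L_in_ASU by blast+
  then have "K (y k) + (\<Sum>m\<in>N. K (y m)) = K (y k + (\<Sum>m\<in>N. y m))"
    by (simp add: K_add K_sum ASU_sum)
  then have "qh k *\<^sub>R y k + (\<Sum>m\<in>N. qh m *\<^sub>R y m) = 0"
    using insert.prems(1) by (simp add: sum K_zero L_iff)
  moreover have "qh k *\<^sub>R y k + (\<Sum>m\<in>N. qh k *\<^sub>R y m) = 0"
    using arg_cong[OF sum, of "(*\<^sub>R) (qh k)"] by (simp add: scaleR_add_right scaleR_sum_right)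
  ultimately have "(\<Sum>m\<in>N. qh m *\<^sub>R y m) = (\<Sum>m\<in>N. qh k *\<^sub>R y m)"
    by (metis add_left_cancel)
  then have "(\<Sum>m\<in>N. (qh m - qh k) *\<^sub>R y m) = 0"
    by (simp add: scaleR_diff_left sum_subtractf)
  then have "(qh m - qh k) *\<^sub>R y m = 0" if "m \<in> N" for m
    using insert.IH[of "\<lambda>m. (qh m - qh k) *\<^sub>R y m" m] insert.prems(1) that by (simp add: L_scaleR)
  then have "y m = 0" if "m \<in> N" for m
    using that insert.hyps qh_inj[of m k] by auto
  then show ?case
    using insert sum by auto
qed simp

text \<open>An expression of \<open>x\<close> by words may involve words of other weights; by
  independence of the degrees their contributions vanish, which leaves words of weight n.\<close>

lemma L_induct [consumes 1, case_names word add scaleC]: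
  assumes x: "x \<in> L n"
    and word: "\<And>w. word_weight w = n \<Longrightarrow> P (word w)"
    and zero: "P 0"
    and add: "\<And>x y. x \<in> L n \<Longrightarrow> y \<in> L n \<Longrightarrow> P x \<Longrightarrow> P y \<Longrightarrow> P (x + y)"
    and scaleC: "\<And>z x. x \<in> L n \<Longrightarrow> P x \<Longrightarrow> P (z *\<^sub>C x)"
  shows "P x"
proof -
  obtain p where p: "x = nceval \<alpha> \<gamma> p"
    using x by (auto simp: L_iff ASU_def)
  define t where "t w = Poly_Mapping.lookup p w *\<^sub>C word w" for w
  define W where "W m = {w \<in> Poly_Mapping.keys p. word_weight w = m}" for m
  define N where "N = insert n (word_weight ` Poly_Mapping.keys p)"
  define y where "y m = (\<Sum>w\<in>W m. t w)" for m
  have "t w \<in> L (word_weight w)" for w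
    by (auto simp: t_def intro: L_scaleC word_in_L)
  then have y: "y m \<in> L m" for m
    by (auto simp: y_def W_def intro!: L_sum)
  have sum: "P (\<Sum>w\<in>S. t w) \<and> (\<Sum>w\<in>S. t w) \<in> L n" if "S \<subseteq> W n" for S
    using that
  proof (induction S rule: infinite_finite_induct)
    case (insert w S)
    then have w: "P (word w)" "word w \<in> L n"
      using word word_in_L by (auto simp: W_def)
    then have "P (t w)" "t w \<in> L n"
      unfolding t_def by (auto intro: scaleC L_scaleC)
    then show ?case
      using insert by (auto intro: add L_add)
  qed (auto intro: zero L_zero)
  have N: "finite N" "n \<in> N"
    by (auto simp: N_def)
  have "x = (\<Sum>m\<in>word_weight ` Poly_Mapping.keys p. y m)"
    unfolding p nceval_def y_def W_def t_def[symmetric] by (rule sum.image_gen) simp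
  also have "\<dots> = (\<Sum>m\<in>N. y m)"
    by (rule sum.mono_neutral_left) (use N in \<open>auto simp: N_def y_def W_def intro!: sum.neutral\<close>)
  finally have "x = (\<Sum>m\<in>N. y m)" .
  \<comment> \<open>Moving \<open>x\<close> into its own degree turns the decomposition into a
    relation between components of distinct degrees.\<close>
  then have "(\<Sum>m\<in>N. y m - (if m = n then x else 0)) = 0"
    using N by (simp add: sum_subtractf)
  then have "y n - (if n = n then x else 0) = 0"
    using N y x by (intro L_independent[of N "\<lambda>m. y m - (if m = n then x else 0)"]) (auto intro: L_diff)
  then have "x = y n"
    by simp
  then show ?thesis
    using sum[of "W n"] by (simp add: y_def)
qed

subsection \<open>The twisted derivation F\<close>

lemma
  shows F_in_ASU: "x \<in> ASU G \<Longrightarrow> F x \<in> ASU G"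
    and F_add: "x \<in> ASU G \<Longrightarrow> y \<in> ASU G \<Longrightarrow> F (x + y) = F x + F y"
    and F_scaleC: "x \<in> ASU G \<Longrightarrow> F (z *\<^sub>C x) = z *\<^sub>C F x"
    and F_mult: "x \<in> ASU G \<Longrightarrow> y \<in> ASU G \<Longrightarrow> F (x * y) = F x * K y + act_Kinv G x * F y"
    and F_gens: "F 1 = 0" "F \<alpha> = 0" "F \<gamma> = 0" "F \<alpha>s = \<gamma>" "F \<gamma>s = - ((1 / q) *\<^sub>R \<alpha>)"
  using quantum_SU2
  by (auto simp: quantum_SU2_def F_spec_def Let_def complex_linear_on_def)

lemma F_scaleR: "x \<in> ASU G \<Longrightarrow> F (r *\<^sub>R x) = r *\<^sub>R F x"
  by (simp add: scaleR_scaleC F_scaleC)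

lemma F_mult_L:
  "x \<in> L m \<Longrightarrow> y \<in> L n \<Longrightarrow> F (x * y) = qh n *\<^sub>R (F x * y) + qh (- m) *\<^sub>R (x * F y)"
  using F_mult[of x y] Kinv_L[of x m] by (simp add: L_iff)

text \<open>On words F lowers the weight by 2, and 1 / q is \<open>qh (- 2)\<close>; both sides are
  linear.\<close>

lemma K_F: "x \<in> ASU G \<Longrightarrow> K (F x) = (1 / q) *\<^sub>R F (K x)"
proof (induction rule: ASU_induct)
  case (word w)
  have "F (word w) \<in> L (word_weight w - 2)"
  proof (induction w rule: word_induct)
    case Nil
    then show ?case
      by (simp add: word_NCW_Nil F_gens L_zero)
  next
    case (Cons l ls)
    have "F (letter_val \<alpha> \<gamma> l) \<in> L (letter_weight l - 2)"
      using gens_in_L L_scaleR[OF gens_in_L(1), of "- 1 / q"]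
      by (cases l) (auto simp: F_gens L_zero)
    then have "F (letter_val \<alpha> \<gamma> l) * word (NCW ls) \<in> L (letter_weight l + word_weight (NCW ls) - 2)"
      by (rule L_mult') (auto intro: word_in_L)
    moreover have "letter_val \<alpha> \<gamma> l * F (word (NCW ls)) \<in> L (letter_weight l + word_weight (NCW ls) - 2)"
      by (rule L_mult'[OF letter_in_L Cons]) simp
    ultimately show ?case
      using F_mult_L[OF letter_in_L word_in_L, of l "NCW ls"]
      by (simp add: word_NCW_Cons L_add L_scaleR)
  qed
  then show ?case
    using word_in_L[of w] qh_add[of "word_weight w" "- 2"]
    by (simp add: L_iff F_scaleR qh_minus_2)
qed (simp_all add: K_add K_scaleC F_add F_scaleC F_in_ASU K_in_ASU scaleR_add_right scaleC_scaleR)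

lemma F_in_L: "x \<in> L n \<Longrightarrow> F x \<in> L (n - 2)"
  using K_F[of x] qh_add[of n "- 2"] by (simp add: L_iff F_in_ASU F_scaleR qh_minus_2)

end

context quantum_su2
begin

section \<open>Surjectivity of F from degree 0 to degree -2\<close>

inductive_set normal_span :: "int \<Rightarrow> 'b set" for n where
  zero: "0 \<in> normal_span n"
| mono: "- int i - int j + int k = n \<Longrightarrow> \<alpha> ^ i * \<gamma> ^ j * \<gamma>s ^ k \<in> normal_span n"
| mono': "int i - int j + int k = n \<Longrightarrow> \<alpha>s ^ i * \<gamma> ^ j * \<gamma>s ^ k \<in> normal_span n"
| add: "x \<in> normal_span n \<Longrightarrow> y \<in> normal_span n \<Longrightarrow> x + y \<in> normal_span n"
| scaleC: "x \<in> normal_span n \<Longrightarrow> z *\<^sub>C x \<in> normal_span n"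

lemma normal_span_scaleR: "x \<in> normal_span n \<Longrightarrow> r *\<^sub>R x \<in> normal_span n"
  by (simp add: scaleR_scaleC normal_span.scaleC)

lemma normal_span_diff:
  "x \<in> normal_span n \<Longrightarrow> y \<in> normal_span n \<Longrightarrow> x - y \<in> normal_span n"
  using normal_span.add[of x n "(-1) *\<^sub>R y"] normal_span_scaleR[of y n "-1"] by simp

text \<open>Stated for any \<open>x\<close> that commutes with c and c* up to one common factor, so
  as to serve powers of a and of a* alike.\<close>

lemma \<gamma>\<gamma>s_mono:
  assumes "\<gamma> * x = r *\<^sub>R (x * \<gamma>)" "\<gamma>s * x = r *\<^sub>R (x * \<gamma>s)"
  shows "\<gamma> * (x * \<gamma> ^ j * \<gamma>s ^ k) = r *\<^sub>R (x * \<gamma> ^ Suc j * \<gamma>s ^ k)"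
    and "\<gamma>s * (x * \<gamma> ^ j * \<gamma>s ^ k) = r *\<^sub>R (x * \<gamma> ^ j * \<gamma>s ^ Suc k)"
proof -
  have "\<gamma> * (x * \<gamma> ^ j * \<gamma>s ^ k) = (\<gamma> * x) * (\<gamma> ^ j * \<gamma>s ^ k)"
    by (simp add: mult.assoc)
  then show "\<gamma> * (x * \<gamma> ^ j * \<gamma>s ^ k) = r *\<^sub>R (x * \<gamma> ^ Suc j * \<gamma>s ^ k)"
    by (simp add: assms mult.assoc)
  have "\<gamma>s * (x * \<gamma> ^ j * \<gamma>s ^ k) = (\<gamma>s * x) * (\<gamma> ^ j * \<gamma>s ^ k)"
    by (simp add: mult.assoc)
  also have "\<dots> = r *\<^sub>R (x * (\<gamma>s * \<gamma> ^ j) * \<gamma>s ^ k)"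
    by (simp add: assms mult.assoc)
  also have "\<dots> = r *\<^sub>R (x * \<gamma> ^ j * \<gamma>s ^ Suc k)"
    by (simp add: \<gamma>s_power_\<gamma> mult.assoc)
  finally show "\<gamma>s * (x * \<gamma> ^ j * \<gamma>s ^ k) = r *\<^sub>R (x * \<gamma> ^ j * \<gamma>s ^ Suc k)" .
qed

lemmas \<gamma>_\<alpha>_mono = \<gamma>\<gamma>s_mono[OF mult_power_scaled[OF \<gamma>\<alpha>] mult_power_scaled[OF \<gamma>s\<alpha>]]
lemmas \<gamma>_\<alpha>s_mono = \<gamma>\<gamma>s_mono[OF mult_power_scaled[OF \<gamma>\<alpha>s] mult_power_scaled[OF \<gamma>s\<alpha>s]]

lemma \<alpha>_mono: "\<alpha> * (\<alpha> ^ i * \<gamma> ^ j * \<gamma>s ^ k) = \<alpha> ^ Suc i * \<gamma> ^ j * \<gamma>s ^ k"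
  and \<alpha>s_mono': "\<alpha>s * (\<alpha>s ^ i * \<gamma> ^ j * \<gamma>s ^ k) = \<alpha>s ^ Suc i * \<gamma> ^ j * \<gamma>s ^ k"
  by (simp_all add: mult.assoc)

text \<open>An adjacent pair is removed by a* a = 1 - c c*. The price is one more c and one more c*,
  whose degrees cancel.\<close>

lemma \<alpha>s_mono:
  "\<alpha>s * (\<alpha> ^ Suc i * \<gamma> ^ j * \<gamma>s ^ k)
    = \<alpha> ^ i * \<gamma> ^ j * \<gamma>s ^ k - ((1 / q) ^ i * (1 / q) ^ i) *\<^sub>R (\<alpha> ^ i * \<gamma> ^ Suc j * \<gamma>s ^ Suc k)"
proof -
  let ?m = "\<alpha> ^ i * \<gamma> ^ j * \<gamma>s ^ k"
  have "\<alpha>s * (\<alpha> ^ Suc i * \<gamma> ^ j * \<gamma>s ^ k) = (\<alpha>s * \<alpha>) * ?m"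
    by (simp add: mult.assoc)
  also have "\<dots> = ?m - \<gamma> * (\<gamma>s * ?m)"
    by (simp add: \<alpha>s\<alpha> left_diff_distrib mult.assoc)
  finally show ?thesis
    by (simp only: \<gamma>_\<alpha>_mono mult_scaleR_right scaleR_scaleR)
qed

lemma \<alpha>_mono':
  "\<alpha> * (\<alpha>s ^ Suc i * \<gamma> ^ j * \<gamma>s ^ k)
    = \<alpha>s ^ i * \<gamma> ^ j * \<gamma>s ^ k - (q\<^sup>2 * (q ^ i * q ^ i)) *\<^sub>R (\<alpha>s ^ i * \<gamma> ^ Suc j * \<gamma>s ^ Suc k)"
proof -
  let ?m = "\<alpha>s ^ i * \<gamma> ^ j * \<gamma>s ^ k"
  have "\<alpha> * (\<alpha>s ^ Suc i * \<gamma> ^ j * \<gamma>s ^ k) = (\<alpha> * \<alpha>s) * ?m"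
    by (simp add: mult.assoc)
  also have "\<dots> = ?m - q\<^sup>2 *\<^sub>R (\<gamma> * (\<gamma>s * ?m))"
    by (simp add: \<alpha>\<alpha>s left_diff_distrib mult.assoc)
  finally show ?thesis
    by (simp only: \<gamma>_\<alpha>s_mono mult_scaleR_right scaleR_scaleR)
qed

lemma letter_normal_span:
  "x \<in> normal_span n \<Longrightarrow> letter_val \<alpha> \<gamma> l * x \<in> normal_span (letter_weight l + n)"
proof (induction rule: normal_span.induct)
  case (mono i j k)
  show ?case
  proof (cases l)
    case LA
    with mono show ?thesis
      unfolding LA letter_val.simps \<alpha>_mono by (intro normal_span.mono) simp
  next
    case LAs
    show ?thesis
    proof (cases i)
      \<comment> \<open>No a is left to cancel, so the product moves to the other family.\<close>
      case 0
      with mono show ?thesis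
        unfolding LAs letter_val.simps
        using \<alpha>s_mono'[of 0 j k] by (auto intro!: normal_span.mono'[of 1 j k, simplified])
    next
      case (Suc i')
      with mono show ?thesis
        unfolding LAs letter_val.simps Suc \<alpha>s_mono
        by (intro normal_span_diff normal_span_scaleR normal_span.mono) simp_all
    qed
  next
    case LC
    with mono show ?thesis
      unfolding LC letter_val.simps \<gamma>_\<alpha>_mono by (intro normal_span_scaleR normal_span.mono) simp
  next
    case LCs
    with mono show ?thesis
      unfolding LCs letter_val.simps \<gamma>_\<alpha>_mono by (intro normal_span_scaleR normal_span.mono) simp
  qed
next
  case (mono' i j k)
  show ?case
  proof (cases l)
    case LA
    show ?thesis
    proof (cases i)
      case 0
      with mono' show ?thesis
        unfolding LA letter_val.simps
        using \<alpha>_mono[of 0 j k] by (auto intro!: normal_span.mono[of 1 j k, simplified])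
    next
      case (Suc i')
      with mono' show ?thesis
        unfolding LA letter_val.simps Suc \<alpha>_mono'
        by (intro normal_span_diff normal_span_scaleR normal_span.mono') simp_all
    qed
  next
    case LAs
    with mono' show ?thesis
      unfolding LAs letter_val.simps \<alpha>s_mono' by (intro normal_span.mono') simp
  next
    case LC
    with mono' show ?thesis
      unfolding LC letter_val.simps \<gamma>_\<alpha>s_mono by (intro normal_span_scaleR normal_span.mono') simp
  next
    case LCs
    with mono' show ?thesis
      unfolding LCs letter_val.simps \<gamma>_\<alpha>s_mono by (intro normal_span_scaleR normal_span.mono') simp
  qed
qed (auto simp: distrib_left mult_scaleC_right intro: normal_span.intros)

lemma L_subset_normal_span: "x \<in> L n \<Longrightarrow> x \<in> normal_span n"
proof (induction rule: L_induct)
  case (word w)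
  have "word w \<in> normal_span (word_weight w)"
    by (induction w rule: word_induct)
      (use normal_span.mono[of 0 0 0 0] in \<open>auto simp: word_NCW_Nil word_NCW_Cons intro: letter_normal_span\<close>)
  with word show ?case
    by simp
qed (auto intro: normal_span.intros)

section \<open>F on powers, and preimages of monomials\<close>

lemma F_mult_zero_left: "x \<in> L m \<Longrightarrow> y \<in> L n \<Longrightarrow> F x = 0 \<Longrightarrow> F (x * y) = qh (- m) *\<^sub>R (x * F y)"
  by (simp add: F_mult_L)

lemma F_power_zero:
  assumes "x \<in> L m" "F x = 0"
  shows "F (x ^ k) = 0"
proof (induction k)
  case (Suc k)
  then show ?case
    using F_mult_zero_left[OF assms(1) L_power[OF assms(1)] assms(2), of k] by simp
qed (simp add: F_gens)

text \<open>Both terms of the twisted Leibniz rule contribute with the same sign, so nothing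
  cancels. Only the sign is kept: being opposite to the one in \<open>F_power_\<alpha>s\<close>, it
  prevents cancellation in \<open>F_image_mono'\<close>.\<close>

lemma F_power_\<gamma>s: "\<exists>r<0. F (\<gamma>s ^ Suc k) = r *\<^sub>R (\<alpha> * \<gamma>s ^ k)"
proof (induction k)
  case 0
  then show ?case
    using q_pos by (intro exI[of _ "- (1 / q)"]) (simp add: F_gens)
next
  case (Suc k)
  then obtain r where r: "r < 0" "F (\<gamma>s ^ Suc k) = r *\<^sub>R (\<alpha> * \<gamma>s ^ k)"
    by blast
  let ?r = "- (qh (int (Suc k)) / q) + qh (- 1) * r * (1 / q)"
  have "F (\<gamma>s ^ Suc (Suc k))
    = qh (int (Suc k)) *\<^sub>R (F \<gamma>s * \<gamma>s ^ Suc k) + qh (- 1) *\<^sub>R (\<gamma>s * F (\<gamma>s ^ Suc k))"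
    unfolding power_Suc[of _ "Suc k"] by (rule F_mult_L[OF gens_in_L(4) powers_in_L(4)])
  also have "\<gamma>s * F (\<gamma>s ^ Suc k) = r *\<^sub>R ((\<gamma>s * \<alpha>) * \<gamma>s ^ k)"
    unfolding r(2) by (simp add: mult.assoc)
  also have "\<dots> = (r * (1 / q)) *\<^sub>R (\<alpha> * \<gamma>s ^ Suc k)"
    by (simp add: \<gamma>s\<alpha> mult.assoc)
  also have "F \<gamma>s * \<gamma>s ^ Suc k = (- (1 / q)) *\<^sub>R (\<alpha> * \<gamma>s ^ Suc k)"
    by (simp add: F_gens)
  finally have "F (\<gamma>s ^ Suc (Suc k)) = ?r *\<^sub>R (\<alpha> * \<gamma>s ^ Suc k)"
    by (simp add: scaleR_add_left scaleR_diff_left mult.assoc)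
  moreover have "qh (- 1) * r * (1 / q) < 0" "qh (int (Suc k)) / q > 0"
    using r q_pos by (simp_all add: mult_pos_neg divide_neg_pos)
  then have "?r < 0"
    by linarith
  ultimately show ?case
    by blast
qed

lemma F_power_\<alpha>s: "\<exists>r>0. F (\<alpha>s ^ Suc k) = r *\<^sub>R (\<gamma> * \<alpha>s ^ k)"
proof (induction k)
  case 0
  then show ?case
    by (intro exI[of _ 1]) (simp add: F_gens)
next
  case (Suc k)
  then obtain r where r: "r > 0" "F (\<alpha>s ^ Suc k) = r *\<^sub>R (\<gamma> * \<alpha>s ^ k)"
    by blast
  let ?r = "qh (int (Suc k)) + qh (- 1) * r * (1 / q)"
  have "F (\<alpha>s ^ Suc (Suc k))
    = qh (int (Suc k)) *\<^sub>R (F \<alpha>s * \<alpha>s ^ Suc k) + qh (- 1) *\<^sub>R (\<alpha>s * F (\<alpha>s ^ Suc k))"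
    unfolding power_Suc[of _ "Suc k"] by (rule F_mult_L[OF gens_in_L(3) powers_in_L(3)])
  also have "\<alpha>s * F (\<alpha>s ^ Suc k) = r *\<^sub>R ((\<alpha>s * \<gamma>) * \<alpha>s ^ k)"
    unfolding r(2) by (simp add: mult.assoc)
  also have "\<dots> = (r * (1 / q)) *\<^sub>R (\<gamma> * \<alpha>s ^ Suc k)"
    by (simp add: \<alpha>s\<gamma> mult.assoc)
  finally have "F (\<alpha>s ^ Suc (Suc k)) = ?r *\<^sub>R (\<gamma> * \<alpha>s ^ Suc k)"
    by (simp add: scaleR_add_left mult.assoc F_gens)
  moreover have "?r > 0"
    using r q_pos by (intro add_pos_pos) simp_all
  ultimately show ?case
    by blast
qed

lemma F_image_scaleR:
  assumes "r *\<^sub>R x \<in> F ` L 0" "r \<noteq> 0"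
  shows "x \<in> F ` L 0"
proof -
  obtain y where y: "y \<in> L 0" "F y = r *\<^sub>R x"
    using assms(1) by auto
  then have "F ((1 / r) *\<^sub>R y) = x"
    using assms(2) by (simp add: F_scaleR L_in_ASU)
  then show ?thesis
    using y(1) L_scaleR by blast
qed

lemma F_image_diff: "x \<in> F ` L 0 \<Longrightarrow> y \<in> F ` L 0 \<Longrightarrow> x - y \<in> F ` L 0"
proof clarify
  fix u v assume uv: "u \<in> L 0" "v \<in> L 0"
  have "F u = F (u - v) + F v"
    using F_add[of "u - v" v] L_diff[OF uv] uv by (simp add: L_in_ASU)
  then have "F u - F v = F (u - v)"
    by simp
  then show "F u - F v \<in> F ` L 0"
    using L_diff[OF uv] by simp
qed

text \<open>The assumption says that the degree is -2. Since F kills a and c, on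
  \<open>\<alpha> ^ i * \<gamma> ^ j * \<gamma>s ^ Suc k\<close> it acts on the last factor only and
  produces one a, which moves left past the powers of c at the cost of a power of 1 / q.\<close>

lemma F_image_mono:
  assumes "int k + 2 = int (Suc i) + int j"
  shows "\<alpha> ^ Suc i * \<gamma> ^ j * \<gamma>s ^ k \<in> F ` L 0"
proof -
  obtain r where r: "r < 0" "F (\<gamma>s ^ Suc k) = r *\<^sub>R (\<alpha> * \<gamma>s ^ k)"
    using F_power_\<gamma>s by blast
  have L: "\<alpha> ^ i * \<gamma> ^ j \<in> L (- int i - int j)"
    by (rule L_mult'[OF powers_in_L(1,2)]) simp
  have "F (\<alpha> ^ i * \<gamma> ^ j) = 0"
    using F_mult_zero_left[OF powers_in_L(1,2), of i j] F_power_zero gens_in_L F_gens by simp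
  then have "F (\<alpha> ^ i * \<gamma> ^ j * \<gamma>s ^ Suc k)
    = qh (- (- int i - int j)) *\<^sub>R (\<alpha> ^ i * \<gamma> ^ j * F (\<gamma>s ^ Suc k))"
    by (rule F_mult_zero_left[OF L powers_in_L(4)])
  also have "\<alpha> ^ i * \<gamma> ^ j * F (\<gamma>s ^ Suc k) = r *\<^sub>R (\<alpha> ^ i * (\<gamma> ^ j * \<alpha>) * \<gamma>s ^ k)"
    unfolding r(2) by (simp add: mult.assoc)
  also have "\<dots> = (r * (1 / q) ^ j) *\<^sub>R (\<alpha> ^ Suc i * \<gamma> ^ j * \<gamma>s ^ k)"
    unfolding power_mult_scaled[OF \<gamma>\<alpha>] power_Suc2 by (simp add: mult.assoc)
  finally have "(qh (- (- int i - int j)) * (r * (1 / q) ^ j)) *\<^sub>R (\<alpha> ^ Suc i * \<gamma> ^ j * \<gamma>s ^ k)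
      = F (\<alpha> ^ i * \<gamma> ^ j * \<gamma>s ^ Suc k)"
    by simp
  moreover have "\<alpha> ^ i * \<gamma> ^ j * \<gamma>s ^ Suc k \<in> L 0"
    by (rule L_mult'[OF L powers_in_L(4)]) (use assms in simp)
  moreover have "qh (- (- int i - int j)) * (r * (1 / q) ^ j) \<noteq> 0"
    using r by simp
  ultimately show ?thesis
    using F_image_scaleR by (metis imageI)
qed

lemma \<alpha>s_power_\<gamma>_mono:
  "\<gamma> * \<alpha>s ^ i * (\<gamma> ^ j * \<gamma>s ^ k) = q ^ i *\<^sub>R (\<alpha>s ^ i * \<gamma> ^ Suc j * \<gamma>s ^ k)"
  using \<gamma>_\<alpha>s_mono(1)[of i j k] by (simp add: mult.assoc)

text \<open>F maps the monomial with exponents (i + 1, i + 1 + k, k) to a combination of the monomial below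
  and of the one with k - 1 in place of k. The coefficient of the former is a difference of a
  positive and a negative number, hence nonzero.\<close>

lemma F_image_mono': "\<alpha>s ^ i * \<gamma> ^ (i + k + 2) * \<gamma>s ^ k \<in> F ` L 0"
proof (induction k)
  let ?y = "\<lambda>k. \<alpha>s ^ Suc i * (\<gamma> ^ (Suc i + k) * \<gamma>s ^ k)"
  obtain s where s: "s > 0" "F (\<alpha>s ^ Suc i) = s *\<^sub>R (\<gamma> * \<alpha>s ^ i)"
    using F_power_\<alpha>s by blast
  have L: "\<gamma> ^ (Suc i + k) * \<gamma>s ^ k \<in> L (- int (Suc i))" for k
    by (rule L_mult'[OF powers_in_L(2,4)]) simp
  have y: "?y k \<in> L 0" for k
    by (rule L_mult'[OF powers_in_L(3) L]) simp
  \<comment> \<open>The two factors have opposite degrees, so both twists of the Leibniz rule equal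
    \<open>qh (- int (Suc i))\<close> and factor out.\<close>
  have F_y: "F (?y k) = qh (- int (Suc i)) *\<^sub>R
      ((s * q ^ i) *\<^sub>R (\<alpha>s ^ i * \<gamma> ^ (i + k + 2) * \<gamma>s ^ k)
        + \<alpha>s ^ Suc i * F (\<gamma> ^ (Suc i + k) * \<gamma>s ^ k))" for k
    using F_mult_L[OF powers_in_L(3) L, of "Suc i" k] \<alpha>s_power_\<gamma>_mono[of i "Suc i + k" k]
    by (simp add: s scaleR_add_right del: power_Suc)
  have F_\<gamma>: "F (\<gamma> ^ j) = 0" for j
    using F_power_zero gens_in_L F_gens by blast
  {
    case 0
    have "F (?y 0) = (qh (- int (Suc i)) * (s * q ^ i)) *\<^sub>R (\<alpha>s ^ i * \<gamma> ^ (i + 0 + 2) * \<gamma>s ^ 0)"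
      unfolding F_y by (simp add: F_\<gamma> del: power_Suc)
    then have "(qh (- int (Suc i)) * (s * q ^ i)) *\<^sub>R (\<alpha>s ^ i * \<gamma> ^ (i + 0 + 2) * \<gamma>s ^ 0) \<in> F ` L 0"
      using y[of 0] by (metis imageI)
    then show ?case
      by (rule F_image_scaleR) (use s in simp)
  next
    case (Suc k)
    let ?m = "\<alpha>s ^ i * \<gamma> ^ (i + k + 2) * \<gamma>s ^ k" and ?m' = "\<alpha>s ^ i * \<gamma> ^ (i + Suc k + 2) * \<gamma>s ^ Suc k"
    let ?j = "Suc i + Suc k"
    obtain r where r: "r < 0" "F (\<gamma>s ^ Suc k) = r *\<^sub>R (\<alpha> * \<gamma>s ^ k)"
      using F_power_\<gamma>s by blast
    define C where "C = qh (int ?j) * (r * (1 / q) ^ ?j)"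
    have "C < 0"
      unfolding C_def using r q_pos by (intro mult_pos_neg mult_neg_pos) simp_all
    have "F (\<gamma> ^ ?j * \<gamma>s ^ Suc k) = qh (int ?j) *\<^sub>R (\<gamma> ^ ?j * F (\<gamma>s ^ Suc k))"
      using F_mult_zero_left[OF powers_in_L(2,4) F_\<gamma>, of ?j "Suc k"] by (simp only: minus_minus)
    also have "\<gamma> ^ ?j * F (\<gamma>s ^ Suc k) = r *\<^sub>R ((\<gamma> ^ ?j * \<alpha>) * \<gamma>s ^ k)"
      unfolding r(2) by (simp add: mult.assoc)
    also have "\<dots> = (r * (1 / q) ^ ?j) *\<^sub>R (\<alpha> * (\<gamma> ^ ?j * \<gamma>s ^ k))"
      unfolding power_mult_scaled[OF \<gamma>\<alpha>] by (simp add: mult.assoc)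
    finally have "\<alpha>s ^ Suc i * F (\<gamma> ^ ?j * \<gamma>s ^ Suc k) = C *\<^sub>R (\<alpha>s ^ i * (\<alpha>s * \<alpha>) * (\<gamma> ^ ?j * \<gamma>s ^ k))"
      unfolding power_Suc2[of _ i] by (simp add: C_def mult.assoc del: power_Suc)
    \<comment> \<open>The a produced by F meets an a*, and a* a = 1 - c c* splits the term into the
      monomial \<open>?m\<close> of the induction hypothesis and the target
      \<open>?m'\<close>.\<close>
    also have "\<alpha>s ^ i * (\<alpha>s * \<alpha>) * (\<gamma> ^ ?j * \<gamma>s ^ k)
        = \<alpha>s ^ i * \<gamma> ^ ?j * \<gamma>s ^ k - \<alpha>s ^ i * \<gamma> * (\<gamma>s * \<gamma> ^ ?j) * \<gamma>s ^ k"
      unfolding \<alpha>s\<alpha> by (simp add: left_diff_distrib right_diff_distrib mult.assoc)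
    also have "\<dots> = ?m - ?m'"
      unfolding \<gamma>s_power_\<gamma> by (simp add: mult.assoc)
    finally have "\<alpha>s ^ Suc i * F (\<gamma> ^ ?j * \<gamma>s ^ Suc k) = C *\<^sub>R (?m - ?m')" .
    then have "F (?y (Suc k)) = qh (- int (Suc i)) *\<^sub>R ((s * q ^ i - C) *\<^sub>R ?m' + C *\<^sub>R ?m)"
      unfolding F_y by (simp only: scaleR_diff_left scaleR_diff_right add_diff_eq diff_add_eq)
    then have "qh (- int (Suc i)) *\<^sub>R ((s * q ^ i - C) *\<^sub>R ?m' + C *\<^sub>R ?m) \<in> F ` L 0"
      using y[of "Suc k"] by (metis imageI)
    then have "(s * q ^ i - C) *\<^sub>R ?m' + C *\<^sub>R ?m \<in> F ` L 0"
      by (rule F_image_scaleR) simp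
    moreover have "C *\<^sub>R ?m \<in> F ` L 0"
      by (rule F_image_scaleR[of "1 / C"]) (use \<open>C < 0\<close> Suc.IH in simp_all)
    ultimately have "(s * q ^ i - C) *\<^sub>R ?m' + C *\<^sub>R ?m - C *\<^sub>R ?m \<in> F ` L 0"
      by (rule F_image_diff)
    then have "(s * q ^ i - C) *\<^sub>R ?m' \<in> F ` L 0"
      by (simp only: add_diff_cancel_right')
    moreover have "s * q ^ i > 0"
      using s q_pos by simp
    then have "s * q ^ i - C \<noteq> 0"
      using \<open>C < 0\<close> by linarith
    ultimately show ?case
      by (rule F_image_scaleR)
  }
qed

theorem F_surj: "F ` L 0 = L (- 2)"
proof
  show "F ` L 0 \<subseteq> L (- 2)"
    using F_in_L[of _ 0] by auto
  show "L (- 2) \<subseteq> F ` L 0"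
  proof
    fix z assume "z \<in> L (- 2)"
    then have "z \<in> normal_span (- 2)"
      by (rule L_subset_normal_span)
    then show "z \<in> F ` L 0"
    proof (induction rule: normal_span.induct)
      case zero
      have "F 0 = 0"
        using F_scaleR[OF ASU_zero, of 0] by simp
      then show ?case
        using L_zero by (metis imageI)
    next
      case (mono i j k)
      show ?case
      proof (cases i)
        case 0
        \<comment> \<open>Without a factor a the monomial also belongs to the second family, with
          exponent 0 of a*.\<close>
        with mono have "j = 0 + k + 2"
          by linarith
        then show ?thesis
          using F_image_mono'[of 0 k] 0 by simp
      next
        case (Suc i')
        then show ?thesis
          using F_image_mono[of k i' j] mono by simp
      qed
    next
      case (mono' i j k)
      then have "j = i + k + 2"
        by linarith
      then show ?case
        using F_image_mono'[of i k] by simp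
    next
      case (add x y)
      then obtain u v where "u \<in> L 0" "v \<in> L 0" "F u = x" "F v = y"
        by auto
      then have "F (u + v) = x + y" "u + v \<in> L 0"
        by (simp_all add: F_add L_in_ASU L_add)
      then show ?case
        by (metis imageI)
    next
      case (scaleC x z)
      then obtain u where "u \<in> L 0" "F u = x"
        by auto
      then have "F (z *\<^sub>C u) = z *\<^sub>C x" "z *\<^sub>C u \<in> L 0"
        by (simp_all add: F_scaleC L_in_ASU L_scaleC)
      then show ?case
        by (metis imageI)
    qed
  qed
qed

end

interpretation blinfun_compose: bounded_bilinear blinfun_compose
  by (rule bounded_bilinear_blinfun_compose)

context quantum_su2
begin

section \<open>Holomorphic structures\<close>

lemma ACP_eq: "ACP G = L 0"
  by (simp add: ACP_def)

text \<open>Elements of degree m are sums of products of degrees m - n and n: insert 1 = a a* + q^2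
  c c* or 1 = a* a + c* c on the right, which moves one unit of degree per step, \<sigma> being the
  sign of n. An arbitrary additively closed \<open>W\<close> stands for the set of these sums and
  may vary in the induction.\<close>

lemma L_factorise_nat:
  assumes "z \<in> L m" "\<And>x y. x \<in> W \<Longrightarrow> y \<in> W \<Longrightarrow> x + y \<in> W"
    and "\<And>y v. y \<in> L (m - \<sigma> * int k) \<Longrightarrow> v \<in> L (\<sigma> * int k) \<Longrightarrow> y * v \<in> W"
    and \<sigma>: "\<sigma> = 1 \<or> \<sigma> = - 1"
  shows "z \<in> W"
  using assms(1-3)
proof (induction k arbitrary: m z W)
  case 0
  then show ?case
    using L_one by fastforce
next
  case (Suc k)
  have step: "x * b \<in> W" if "x \<in> L (m - \<sigma>)" "b \<in> L \<sigma>" for x b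
  proof -
    \<comment> \<open>The induction hypothesis is used for the elements whose product with
      \<open>b\<close> lies in \<open>W\<close>; thus \<open>b\<close> joins the right
      factor.\<close>
    have "x \<in> {y. y * b \<in> W}"
    proof (rule Suc.IH[OF that(1)])
      fix y v assume "y \<in> L (m - \<sigma> - \<sigma> * int k)" "v \<in> L (\<sigma> * int k)"
      then have "y * (v * b) \<in> W"
        using that(2) by (intro Suc.prems(3)) (auto simp: algebra_simps intro: L_mult')
      then show "y * v \<in> {y. y * b \<in> W}"
        by (simp add: mult.assoc)
    qed (auto simp: distrib_right intro: Suc.prems(2))
    then show ?thesis
      by simp
  qed
  have gens: "z * x \<in> L (m + n)" if "x \<in> L n" for x n
    using Suc.prems(1) that by (rule L_mult)
  from \<sigma> show ?case
  proof
    assume \<sigma>: "\<sigma> = 1"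
    have "z = z * (\<alpha> * \<alpha>s + q\<^sup>2 *\<^sub>R (\<gamma> * \<gamma>s))"
      by (simp add: \<alpha>\<alpha>s)
    also have "\<dots> = (z * \<alpha>) * \<alpha>s + (q\<^sup>2 *\<^sub>R (z * \<gamma>)) * \<gamma>s"
      by (simp add: distrib_left mult.assoc)
    also have "\<dots> \<in> W"
      using gens[OF gens_in_L(1)] gens[OF gens_in_L(2)] gens_in_L \<sigma>
      by (intro Suc.prems(2) step L_scaleR) simp_all
    finally show ?thesis .
  next
    assume \<sigma>: "\<sigma> = - 1"
    have "z = z * (\<alpha>s * \<alpha> + \<gamma>s * \<gamma>)"
      by (simp add: \<alpha>s\<alpha> \<gamma>s\<gamma>)
    also have "\<dots> = (z * \<alpha>s) * \<alpha> + (z * \<gamma>s) * \<gamma>"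
      by (simp add: distrib_left mult.assoc)
    also have "\<dots> \<in> W"
      using gens[OF gens_in_L(3)] gens[OF gens_in_L(4)] gens_in_L \<sigma>
      by (intro Suc.prems(2) step) simp_all
    finally show ?thesis .
  qed
qed

lemma L_factorise:
  assumes "z \<in> L m" "\<And>x y. x \<in> W \<Longrightarrow> y \<in> W \<Longrightarrow> x + y \<in> W"
    and "\<And>y v. y \<in> L (m - n) \<Longrightarrow> v \<in> L n \<Longrightarrow> y * v \<in> W"
  shows "z \<in> W"
proof (cases "n \<ge> 0")
  case True
  then show ?thesis
    using L_factorise_nat[of z m W 1 "nat n"] assms by simp
next
  case False
  then show ?thesis
    using L_factorise_nat[of z m W "- 1" "nat (- n)"] assms by simp
qed

lemma Omega01_tensor_add_simple:
  assumes "x \<in> Omega01_tensor G n" "\<eta> \<in> L (- 2)" "s \<in> L n"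
  shows "x + form_rmult G \<eta> s \<in> Omega01_tensor G n"
proof -
  obtain k :: nat and \<eta>' s' where x: "x = (\<Sum>i<k. form_rmult G (\<eta>' i) (s' i))"
    "\<forall>i<k. \<eta>' i \<in> L (- 2)" "\<forall>i<k. s' i \<in> L n"
    using assms(1) by (auto simp: Omega01_tensor_def Omega01_def)
  have "x + form_rmult G \<eta> s = (\<Sum>i<Suc k. form_rmult G ((\<eta>'(k := \<eta>)) i) ((s'(k := s)) i))"
    by (simp add: x(1))
  moreover have "\<forall>i<Suc k. (\<eta>'(k := \<eta>)) i \<in> L (- 2)" "\<forall>i<Suc k. (s'(k := s)) i \<in> L n"
    using x assms by (auto simp: less_Suc_eq)
  ultimately show ?thesis
    unfolding Omega01_tensor_def Omega01_def by blast
qed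

lemma Omega01_tensor_add:
  assumes "x \<in> Omega01_tensor G n" "y \<in> Omega01_tensor G n"
  shows "x + y \<in> Omega01_tensor G n"
proof -
  obtain k :: nat and \<eta> s where y: "y = (\<Sum>i<k. form_rmult G (\<eta> i) (s i))"
    "\<forall>i<k. \<eta> i \<in> L (- 2)" "\<forall>i<k. s i \<in> L n"
    using assms(2) by (auto simp: Omega01_tensor_def Omega01_def)
  have "x + (\<Sum>i<j. form_rmult G (\<eta> i) (s i)) \<in> Omega01_tensor G n" if "j \<le> k" for j
    using that
  proof (induction j)
    case (Suc j)
    then show ?case
      using Omega01_tensor_add_simple[of "x + (\<Sum>i<j. form_rmult G (\<eta> i) (s i))" n "\<eta> j" "s j"] y
      by (simp add: add.assoc)
  qed (simp add: assms)
  then show ?thesis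
    by (simp add: y(1))
qed

lemma form_rmult_L: "s \<in> L n \<Longrightarrow> form_rmult G y s = (qh n * qh n) *\<^sub>R (y * s)"
  by (simp add: form_rmult_def L_iff K_scaleR)

text \<open>Inside the algebra the tensor product contains all of degree n - 2, so the range
  condition on a connection becomes a count of degrees.\<close>

lemma L_subset_Omega01_tensor:
  assumes "z \<in> L (n - 2)"
  shows "z \<in> Omega01_tensor G n"
proof (rule L_factorise[OF assms, of _ n])
  fix y v assume "y \<in> L (n - 2 - n)" "v \<in> L n"
  then have yv: "y \<in> L (- 2)" "v \<in> L n"
    by simp_all
  have "0 \<in> Omega01_tensor G n"
    unfolding Omega01_tensor_def by (auto intro!: exI[of _ 0])
  \<comment> \<open>The scalar undoes the twist by the square of \<open>K\<close> in
    \<open>form_rmult\<close>.\<close>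
  from Omega01_tensor_add_simple[OF this L_scaleR[OF yv(1)] yv(2), of "qh (- n) * qh (- n)"]
  show "y * v \<in> Omega01_tensor G n"
    using yv by (simp add: form_rmult_L flip: qh_add)
qed (rule Omega01_tensor_add)

lemma X_minus_L: "s \<in> L n \<Longrightarrow> X_minus G s = qh (n - 1) *\<^sub>R F s"
  using qh_add[of n "- 1"] by (simp add: X_minus_def L_iff F_scaleR) (simp add: qh_def)

text \<open>The prefactor q^(2 - n) of the standard connection is the inverse of the square of
  \<open>K\<close> on degree n - 2, which appears when \<omega>_- moves past
  \<open>X_minus G s\<close>; the two cancel.\<close>

lemma nabla_L:
  assumes "s \<in> L n" "f \<in> L 0"
  shows "nabla G n f s = qh (n - 1) *\<^sub>R F s - qh (- 1) *\<^sub>R (s * F f)"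
proof -
  have "q powr of_int (2 - n) = qh (4 - 2 * n)"
    by (simp add: qh_def diff_divide_distrib)
  moreover have "qh (4 - 2 * n) * (qh (n - 2) * qh (n - 2)) = 1"
    by (simp flip: qh_add)
  ultimately have "nabla_std G n s = X_minus G s"
    using F_in_L[OF assms(1)]
    by (simp add: nabla_std_def X_minus_L[OF assms(1)] form_rmult_L[OF L_scaleR] mult.assoc)
  then show ?thesis
    by (simp add: nabla_def twisted_flip_def dbar_form_def X_minus_L[OF assms(1)] X_minus_L[OF assms(2)])
qed

lemma holomorphic_structure_nabla:
  assumes f: "f \<in> L 0"
  shows "holomorphic_structure G n (nabla G n f)"
  unfolding holomorphic_structure_def
proof (intro conjI ballI)
  show "nabla G n f ` L n \<subseteq> Omega01_tensor G n"
  proof clarify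
    fix s assume s: "s \<in> L n"
    have "s * F f \<in> L (n - 2)"
      by (rule L_mult'[OF s F_in_L[OF f]]) simp
    then show "nabla G n f s \<in> Omega01_tensor G n"
      unfolding nabla_L[OF s f]
      by (intro L_subset_Omega01_tensor L_diff L_scaleR F_in_L s)
  qed
  show "complex_linear_on (L n) (nabla G n f)"
    unfolding complex_linear_on_def
    by (auto simp: nabla_L[OF _ f] L_add L_scaleC F_add F_scaleC L_in_ASU distrib_right
        scaleR_add_right scaleC_scaleR scaleC_diff_right mult_scaleC_left)
  fix x s assume x: "x \<in> ACP G" and s: "s \<in> L n"
  from x have x: "x \<in> L 0"
    by (simp add: ACP_eq)
  have xs: "x * s \<in> L n"
    by (rule L_mult'[OF x s]) simp
  \<comment> \<open>The twists match: \<open>qh (- 1)\<close> comes from \<open>X_minus\<close> in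
    degree 0, the square of \<open>qh n\<close> from the right action on forms.\<close>
  have "qh (n - 1) * qh n = qh (- 1) * (qh n * qh n)"
    by (simp flip: qh_add)
  then show "nabla G n f (x * s) = x * nabla G n f s + form_rmult G (dbar_form G x) s"
    by (simp add: nabla_L[OF xs f] nabla_L[OF s f] F_mult_L[OF x s] form_rmult_L[OF s]
        dbar_form_def X_minus_L[OF x] scaleR_add_right right_diff_distrib mult.assoc)
qed

section \<open>The derivation and its closure\<close>

abbreviation "D \<equiv> dbar G"
abbreviation "P \<equiv> orth_proj (Hplus G)"

lemma closed_complex_subspace_Hplus: "closed_complex_subspace (Hplus G)"
proof
  show "closed (Hplus G)"
    by (simp add: Hplus_def)
  have "gns 0 \<in> Hplus G"
    unfolding Hplus_def using L_zero closure_subset by fast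
  then show "0 \<in> Hplus G"
    by simp
  show "x + y \<in> Hplus G" if xy: "x \<in> Hplus G" "y \<in> Hplus G" for x y
  proof -
    obtain X Y where X: "\<And>n. X n \<in> gns ` L 1" "X \<longlonglongrightarrow> x" and Y: "\<And>n. Y n \<in> gns ` L 1" "Y \<longlonglongrightarrow> y"
      using xy unfolding Hplus_def closure_sequential by blast
    have "X n + Y n \<in> gns ` L 1" for n
      using X(1)[of n] Y(1)[of n] by (auto simp flip: gns_add intro: L_add)
    then show ?thesis
      unfolding Hplus_def closure_sequential using tendsto_add[OF X(2) Y(2)]
      by (intro exI[of _ "\<lambda>n. X n + Y n"]) simp
  qed
  show "z *\<^sub>C x \<in> Hplus G" if x: "x \<in> Hplus G" for x z
  proof -
    obtain X where X: "\<And>n. X n \<in> gns ` L 1" "X \<longlonglongrightarrow> x"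
      using x unfolding Hplus_def closure_sequential by blast
    have "z *\<^sub>C X n \<in> gns ` L 1" for n
      using X(1)[of n] by (auto simp flip: gns_scaleC intro: L_scaleC)
    moreover have "bounded_linear (\<lambda>x::'h. z *\<^sub>C x)"
      by (rule bounded_linear_intro[of _ "cmod z"]) (simp_all add: scaleC_add_right scaleC_scaleR mult.commute)
    then have "(\<lambda>n. z *\<^sub>C X n) \<longlonglongrightarrow> z *\<^sub>C x"
      using X(2) by (rule bounded_linear.tendsto)
    ultimately show ?thesis
      unfolding Hplus_def closure_sequential by (intro exI[of _ "\<lambda>n. z *\<^sub>C X n"]) simp
  qed
qed

interpretation Hplus: closed_complex_subspace "Hplus G"
  by (rule closed_complex_subspace_Hplus)

lemma rep_Hplus:
  assumes "x \<in> L 0" "\<xi> \<in> Hplus G"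
  shows "blinfun_apply (rep x) \<xi> \<in> Hplus G"
proof -
  have "blinfun_apply (rep x) ` closure (gns ` L 1) \<subseteq> closure (gns ` L 1)"
  proof (rule image_closure_subset)
    show "blinfun_apply (rep x) ` gns ` L 1 \<subseteq> closure (gns ` L 1)"
      using L_mult'[OF assms(1), of _ 1 1] by (auto simp: rep_gns intro!: subsetD[OF closure_subset])
  qed (auto intro: continuous_intros)
  then show ?thesis
    using assms(2) unfolding Hplus_def by blast
qed

text \<open>Both x and x* preserve \<open>Hplus G\<close>, so x also preserves its orthogonal
  complement. This gives the Leibniz rule for operators extended by zero.\<close>

lemma rep_P:
  assumes x: "x \<in> L 0"
  shows "P o\<^sub>L rep x = rep x o\<^sub>L P"
proof (rule blinfun_eqI)
  fix \<xi>
  let ?\<zeta> = "\<xi> - blinfun_apply P \<xi>"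
  have "blinfun_apply P (blinfun_apply (rep x) ?\<zeta>) = 0"
  proof (rule Hplus.orth_proj_zero)
    fix \<eta> assume "\<eta> \<in> Hplus G"
    then have "blinfun_apply (rep (star x)) \<eta> \<in> Hplus G"
      using L_star[OF x] by (intro rep_Hplus) simp_all
    then show "cinner \<eta> (blinfun_apply (rep x) ?\<zeta>) = 0"
      unfolding cinner_rep by (rule Hplus.orth_proj_orthogonal)
  qed
  moreover have "blinfun_apply P (blinfun_apply (rep x) (blinfun_apply P \<xi>))
      = blinfun_apply (rep x) (blinfun_apply P \<xi>)"
    by (intro Hplus.orth_proj_id rep_Hplus x Hplus.orth_proj_in)
  ultimately show "blinfun_apply (P o\<^sub>L rep x) \<xi> = blinfun_apply (rep x o\<^sub>L P) \<xi>"
    by (simp add: blinfun.diff_right)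
qed

section \<open>The derivation on polynomials\<close>

lemma D_eq: "D f = rep (qh (- 1) *\<^sub>R F f) o\<^sub>L P"
  by (simp add: dbar_def qh_def)

lemma D_add: "x \<in> L 0 \<Longrightarrow> y \<in> L 0 \<Longrightarrow> D (x + y) = D x + D y"
  by (simp add: D_eq F_add L_in_ASU scaleR_add_right rep_add blinfun_compose.add_left)

lemma D_scaleR: "x \<in> L 0 \<Longrightarrow> D (r *\<^sub>R x) = r *\<^sub>R D x"
  by (simp add: D_eq F_scaleR L_in_ASU rep_scaleR blinfun_compose.scaleR_left mult.commute)

lemma D_diff: "x \<in> L 0 \<Longrightarrow> y \<in> L 0 \<Longrightarrow> D (x - y) = D x - D y"
  using D_add[of "x - y" y] by (simp add: L_diff)

lemma D_scalar: "D (z *\<^sub>C 1) = 0"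
  by (simp add: D_eq F_scaleC ASU_one F_gens blinfun_compose.zero_left)

lemma D_zero: "D 0 = 0"
  using D_scalar[of 0] by simp

lemma scalar_in_L: "z *\<^sub>C 1 \<in> L 0"
  by (intro L_scaleC L_one)

lemma compose_assoc:
  fixes R S T :: "'h \<Rightarrow>\<^sub>L 'h"
  shows "R o\<^sub>L S o\<^sub>L T = R o\<^sub>L (S o\<^sub>L T)"
  by (rule blinfun_eqI) simp

lemma D_mult:
  assumes "x \<in> L 0" "y \<in> L 0"
  shows "D (x * y) = (D x o\<^sub>L rep y) + (rep x o\<^sub>L D y)"
  using rep_P[OF assms(2)]
  by (simp add: D_eq F_mult_L[OF assms] scaleR_add_right rep_add rep_scaleR rep_mult
      blinfun_compose.add_left blinfun_compose.scaleR_left blinfun_compose.scaleR_right compose_assoc)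

text \<open>As the closure of a graph, the relation is stable under joint limits, which the Neumann
  series requires.\<close>

lemma has_dbar_iff: "has_dbar G x T \<longleftrightarrow> (x, T) \<in> closure ((\<lambda>x. (x, D x)) ` L 0)"
proof
  assume "has_dbar G x T"
  then obtain X where "\<And>k. X k \<in> L 0" "X \<longlonglongrightarrow> x" "(\<lambda>k. D (X k)) \<longlonglongrightarrow> T"
    by (auto simp: has_dbar_def ACP_eq)
  then show "(x, T) \<in> closure ((\<lambda>x. (x, D x)) ` L 0)"
    unfolding closure_sequential
    by (intro exI[of _ "\<lambda>k. (X k, D (X k))"]) (auto intro: tendsto_Pair)
next
  assume "(x, T) \<in> closure ((\<lambda>x. (x, D x)) ` L 0)"
  then obtain Z where Z: "\<And>k. Z k \<in> (\<lambda>x. (x, D x)) ` L 0" "Z \<longlonglongrightarrow> (x, T)"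
    unfolding closure_sequential by blast
  have "snd (Z k) = D (fst (Z k)) \<and> fst (Z k) \<in> L 0" for k
    using Z(1)[of k] by auto
  then show "has_dbar G x T"
    unfolding has_dbar_def ACP_eq using tendsto_fst[OF Z(2)] tendsto_snd[OF Z(2)]
    by (intro exI[of _ "\<lambda>k. fst (Z k)"]) auto
qed

lemma has_dbar_LIMSEQ:
  assumes "\<And>n. has_dbar G (x n) (T n)" "x \<longlonglongrightarrow> y" "T \<longlonglongrightarrow> S"
  shows "has_dbar G y S"
  using assms(1) closed_sequentially[OF closed_closure _ tendsto_Pair[OF assms(2,3)]]
  by (simp add: has_dbar_iff)

lemma has_dbar_D: "x \<in> L 0 \<Longrightarrow> has_dbar G x (D x)"
  by (rule has_dbar_iff[THEN iffD2]) (auto intro: subsetD[OF closure_subset])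

lemma has_dbar_zero: "has_dbar G 0 0"
  using has_dbar_D[OF L_zero] by (simp add: D_zero)

lemma has_dbar_one: "has_dbar G 1 0"
  using has_dbar_D[OF L_one] D_scalar[of 1] by simp

lemma has_dbar_add: "has_dbar G x S \<Longrightarrow> has_dbar G y T \<Longrightarrow> has_dbar G (x + y) (S + T)"
proof -
  assume "has_dbar G x S" "has_dbar G y T"
  then obtain X Y where X: "\<And>k. X k \<in> L 0" "X \<longlonglongrightarrow> x" "(\<lambda>k. D (X k)) \<longlonglongrightarrow> S"
    and Y: "\<And>k. Y k \<in> L 0" "Y \<longlonglongrightarrow> y" "(\<lambda>k. D (Y k)) \<longlonglongrightarrow> T"
    unfolding has_dbar_def ACP_eq by blast
  show ?thesis
    unfolding has_dbar_def ACP_eq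
    by (rule exI[of _ "\<lambda>k. X k + Y k"]) (use X Y in \<open>auto simp: D_add L_add intro!: tendsto_add\<close>)
qed

lemma has_dbar_minus: "has_dbar G x S \<Longrightarrow> has_dbar G (- x) (- S)"
proof -
  assume "has_dbar G x S"
  then obtain X where X: "\<And>k. X k \<in> L 0" "X \<longlonglongrightarrow> x" "(\<lambda>k. D (X k)) \<longlonglongrightarrow> S"
    unfolding has_dbar_def ACP_eq by blast
  have "- X k \<in> L 0 \<and> D (- X k) = - D (X k)" for k
    using L_scaleR[OF X(1), of "-1" k] D_scaleR[OF X(1), of "-1" k] by simp
  then show ?thesis
    unfolding has_dbar_def ACP_eq
    by (intro exI[of _ "\<lambda>k. - X k"]) (use X in \<open>auto intro!: tendsto_minus\<close>)
qed

lemma has_dbar_diff: "has_dbar G x S \<Longrightarrow> has_dbar G y T \<Longrightarrow> has_dbar G (x - y) (S - T)"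
  using has_dbar_add[of x S "- y" "- T"] has_dbar_minus[of y T] by simp

lemma has_dbar_sum:
  "(\<And>i. i \<in> I \<Longrightarrow> has_dbar G (x i) (T i)) \<Longrightarrow> has_dbar G (\<Sum>i\<in>I. x i) (\<Sum>i\<in>I. T i)"
  by (induction I rule: infinite_finite_induct) (auto intro: has_dbar_zero has_dbar_add)

lemma has_dbar_mult:
  "has_dbar G x S \<Longrightarrow> has_dbar G y T \<Longrightarrow> has_dbar G (x * y) ((S o\<^sub>L rep y) + (rep x o\<^sub>L T))"
proof -
  assume "has_dbar G x S" "has_dbar G y T"
  then obtain X Y where X: "\<And>k. X k \<in> L 0" "X \<longlonglongrightarrow> x" "(\<lambda>k. D (X k)) \<longlonglongrightarrow> S"
    and Y: "\<And>k. Y k \<in> L 0" "Y \<longlonglongrightarrow> y" "(\<lambda>k. D (Y k)) \<longlonglongrightarrow> T"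
    unfolding has_dbar_def ACP_eq by blast
  have "X k * Y k \<in> L 0" for k
    using L_mult[OF X(1) Y(1), of k k] by simp
  then show ?thesis
    unfolding has_dbar_def ACP_eq
    by (intro exI[of _ "\<lambda>k. X k * Y k"])
      (use X Y in \<open>auto simp: D_mult intro!: tendsto_mult tendsto_add blinfun_compose.tendsto tendsto_rep\<close>)
qed

text \<open>Neumann series: the coefficients of the differentiated series grow only linearly against
  the geometric decay, so it converges as soon as the series itself does.\<close>

lemma Neumann_in_domain:
  assumes u: "has_dbar G u U" "norm u < 1"
  shows "invertible_in (dbar_domain G) (1 - u)"
proof -
  \<comment> \<open>\<open>E i\<close> is the derivative of u^i, expanded along u^(i + 1) = u
    u^i.\<close>
  define E where "E = rec_nat 0 (\<lambda>i T. (U o\<^sub>L rep (u ^ i)) + (rep u o\<^sub>L T))"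
  have E: "E 0 = 0" "E (Suc i) = (U o\<^sub>L rep (u ^ i)) + (rep u o\<^sub>L E i)" for i
    by (simp_all add: E_def)
  have E_dbar: "has_dbar G (u ^ i) (E i)" for i
    by (induction i) (auto simp: E intro: has_dbar_one has_dbar_mult u)
  have norm_compose: "norm (R o\<^sub>L S) \<le> r * s" if "norm R \<le> r" "norm S \<le> s" for R S :: "'h \<Rightarrow>\<^sub>L 'h" and r s
    using that norm_blinfun_compose[of R S]
    by (meson mult_mono norm_ge_zero order.trans)
  \<comment> \<open>Starting at \<open>Suc i\<close> avoids the exponent i - 1 at i = 0.\<close>
  have bound: "norm (E (Suc i)) \<le> norm U * (real (Suc i) * norm u ^ i)" for i
  proof (induction i)
    case 0
    have "norm (U o\<^sub>L rep 1) \<le> norm U * norm (1::'b)"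
      by (intro norm_compose norm_rep_le) simp
    then show ?case
      by (simp add: E blinfun_compose.zero_right)
  next
    case (Suc i)
    have "norm (U o\<^sub>L rep (u ^ Suc i)) \<le> norm U * norm u ^ Suc i"
      by (intro norm_compose order.trans[OF norm_rep_le norm_power_ineq]) simp
    moreover have "norm (rep u o\<^sub>L E (Suc i)) \<le> norm u * (norm U * (real (Suc i) * norm u ^ i))"
      by (intro norm_compose norm_rep_le Suc.IH)
    ultimately have "norm (E (Suc (Suc i)))
        \<le> norm U * norm u ^ Suc i + norm u * (norm U * (real (Suc i) * norm u ^ i))"
      unfolding E(2)[of "Suc i"] by (rule norm_triangle_mono)
    then show ?case
      by (simp add: algebra_simps)
  qed
  have "summable (\<lambda>i. norm U * (real (Suc i) * norm u ^ i))"
    using geometric_deriv_sums[of "norm u"] u(2) by (intro summable_mult) (simp add: sums_iff)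
  then have "summable (\<lambda>i. E (Suc i))"
    by (rule summable_comparison_test[rotated]) (use bound in blast)
  then have "summable E"
    by (simp only: summable_Suc_iff)
  have summable: "summable (\<lambda>i. u ^ i)"
    using u(2) by (rule complete_algebra_summable_geometric)
  define v where "v = suminf (\<lambda>i. u ^ i)"
  have "has_dbar G v (suminf E)"
    unfolding v_def
    by (rule has_dbar_LIMSEQ[OF _ summable_LIMSEQ[OF summable] summable_LIMSEQ[OF \<open>summable E\<close>]])
      (intro has_dbar_sum E_dbar)
  then have "v \<in> dbar_domain G"
    by (auto simp: dbar_domain_def)
  moreover have "1 - u \<in> dbar_domain G"
    using has_dbar_diff[OF has_dbar_one u(1)] by (auto simp: dbar_domain_def)
  moreover have "u * v = v - 1" "v * u = v - 1"
    using suminf_mult[OF summable, of u] suminf_mult2[OF summable, of u] suminf_split_head[OF summable]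
    by (simp_all add: v_def power_commutes)
  then have "(1 - u) * v = 1" "v * (1 - u) = 1"
    by (simp_all add: left_diff_distrib right_diff_distrib)
  ultimately show ?thesis
    unfolding invertible_in_def by blast
qed

section \<open>Solving the mixed gauge equation\<close>

definition gauge_rhs :: "'b \<Rightarrow> 'b \<Rightarrow> 'b \<Rightarrow> 'h \<Rightarrow>\<^sub>L 'h" where
  "gauge_rhs f h x = (rep x o\<^sub>L D f) - (D h o\<^sub>L rep x)"

lemma gauge_rhs_add: "gauge_rhs f h (x + y) = gauge_rhs f h x + gauge_rhs f h y"
  by (simp add: gauge_rhs_def rep_add blinfun_compose.add_left blinfun_compose.add_right)

lemma gauge_rhs_one: "gauge_rhs f h 1 = D f - D h"
  by (rule blinfun_eqI) (simp add: gauge_rhs_def rep_one blinfun.diff_left)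

lemma tendsto_gauge_rhs: "X \<longlonglongrightarrow> x \<Longrightarrow> (\<lambda>k. gauge_rhs f h (X k)) \<longlonglongrightarrow> gauge_rhs f h x"
  unfolding gauge_rhs_def
  by (intro tendsto_diff blinfun_compose.tendsto tendsto_const tendsto_rep)

lemma norm_gauge_rhs: "norm (gauge_rhs f h x) \<le> (norm (D f) + norm (D h)) * norm x"
proof -
  have "norm (rep x o\<^sub>L D f) \<le> norm x * norm (D f)"
    by (rule order.trans[OF norm_blinfun_compose]) (simp add: mult_right_mono norm_rep_le)
  moreover have "norm (D h o\<^sub>L rep x) \<le> norm (D h) * norm x"
    by (rule order.trans[OF norm_blinfun_compose]) (simp add: mult_left_mono norm_rep_le)
  ultimately show ?thesis
    unfolding gauge_rhs_def
    using norm_triangle_ineq4[of "rep x o\<^sub>L D f" "D h o\<^sub>L rep x"] by (simp add: algebra_simps)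
qed

text \<open>\<open>P\<close> moves past \<open>rep x\<close>, so the right-hand side is, up to
  \<open>qh (- 1)\<close>, multiplication by x (F f) - (F h) x on the range of \<open>P\<close>.
  This element has degree -2, and \<open>F_surj\<close> provides the primitive.\<close>

lemma gauge_rhs_in_range:
  assumes "f \<in> L 0" "h \<in> L 0" "x \<in> L 0"
  shows "\<exists>y\<in>L 0. D y = gauge_rhs f h x"
proof -
  have "x * F f \<in> L (- 2)" "F h * x \<in> L (- 2)"
    using L_mult'[OF assms(3) F_in_L[OF assms(1)]] L_mult'[OF F_in_L[OF assms(2)] assms(3)] by simp_all
  then have "x * F f - F h * x \<in> F ` L 0"
    unfolding F_surj by (rule L_diff)
  then obtain y where y: "y \<in> L 0" "F y = x * F f - F h * x"
    by auto
  have "D y = gauge_rhs f h x"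
    using rep_P[OF assms(3)]
    by (simp add: gauge_rhs_def D_eq y(2) scaleR_diff_right rep_diff rep_scaleR rep_mult
        blinfun_compose.diff_left blinfun_compose.scaleR_left blinfun_compose.scaleR_right compose_assoc)
  with y(1) show ?thesis
    by blast
qed

abbreviation "\<psi> \<equiv> psi_inf G"

section \<open>Consequences of the norm of the integral\<close>

lemma qintegral_norm_upper:
  assumes "y \<in> L 0" "norm (D y) \<le> 1"
  shows "ereal (norm (y - \<psi> y *\<^sub>C 1)) \<le> qintegral_norm G"
proof -
  have "has_qintegral G (D y) (y - \<psi> y *\<^sub>C 1)"
    unfolding has_qintegral_def using assms by (intro exI[of _ "\<lambda>_. y"]) (simp add: ACP_eq)
  with assms(2) show ?thesis
    unfolding qintegral_norm_def by (intro Sup_upper) blast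
qed

text \<open>Here \<open>\<psi>\<close> is applied only after normalising y, so that the bound on the unit ball becomes
  homogeneous without an appeal to the linearity of \<open>\<psi>\<close>.\<close>

lemma bounded_primitive:
  assumes M: "qintegral_norm G = ereal M" and y: "y \<in> L 0"
  shows "\<exists>u\<in>L 0. D u = D y \<and> norm u \<le> M * norm (D y)"
proof (cases "D y = 0")
  case True
  then show ?thesis
    using L_zero D_zero by (intro bexI[of _ 0]) auto
next
  case False
  define t where "t = norm (D y)"
  have t: "t > 0"
    using False by (simp add: t_def)
  define y' where "y' = (1 / t) *\<^sub>R y"
  have y': "y' \<in> L 0" "D y' = (1 / t) *\<^sub>R D y"
    unfolding y'_def using y by (simp_all add: L_scaleR D_scaleR)
  then have "norm (D y') \<le> 1"
    using t by (simp add: t_def)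
  then have "norm (y' - \<psi> y' *\<^sub>C 1) \<le> M"
    using qintegral_norm_upper[OF y'(1)] M by simp
  then have "norm (t *\<^sub>R (y' - \<psi> y' *\<^sub>C 1)) \<le> M * t"
    using t by (simp add: mult.commute)
  moreover have diff: "y' - \<psi> y' *\<^sub>C 1 \<in> L 0"
    by (intro L_diff y' scalar_in_L)
  moreover have "D (t *\<^sub>R (y' - \<psi> y' *\<^sub>C 1)) = D y"
    using t by (simp add: D_scaleR[OF diff] D_diff[OF y'(1) scalar_in_L] D_scalar y'(2))
  ultimately show ?thesis
    by (intro bexI[of _ "t *\<^sub>R (y' - \<psi> y' *\<^sub>C 1)"]) (auto simp: t_def L_scaleR)
qed

text \<open>A nonscalar y differs from the scalar that normalises it, so its derivative has a
  nonzero integral. Applied to f - h, this keeps the denominator of the smallness hypothesis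
  positive.\<close>

lemma qintegral_norm_pos:
  assumes y: "y \<in> L 0" "\<nexists>z. y = z *\<^sub>C 1"
  shows "qintegral_norm G > 0"
proof -
  \<comment> \<open>The maximum with 1 also covers \<open>D y = 0\<close>.\<close>
  define t where "t = max 1 (norm (D y))"
  have t: "t > 0"
    by (simp add: t_def)
  define y' where "y' = (1 / t) *\<^sub>R y"
  have y': "y' \<in> L 0" "D y' = (1 / t) *\<^sub>R D y"
    unfolding y'_def using y by (simp_all add: L_scaleR D_scaleR)
  then have "norm (D y') \<le> 1"
    by (simp add: t_def divide_le_eq)
  then have le: "ereal (norm (y' - \<psi> y' *\<^sub>C 1)) \<le> qintegral_norm G"
    by (rule qintegral_norm_upper[OF y'(1)])
  have "y' \<noteq> \<psi> y' *\<^sub>C 1"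
  proof
    assume *: "y' = \<psi> y' *\<^sub>C 1"
    have "y = t *\<^sub>R y'"
      using t by (simp add: y'_def)
    also have "\<dots> = (of_real t * \<psi> y') *\<^sub>C 1"
      using * by (metis scaleC_of_real scaleC_scaleC)
    finally show False
      using y(2) by blast
  qed
  then have "ereal (norm (y' - \<psi> y' *\<^sub>C 1)) > 0"
    by simp
  with le show ?thesis
    by (rule less_le_trans[rotated])
qed

theorem gauge_solution_exists:
  assumes f: "f \<in> L 0" and h: "h \<in> L 0"
    and M: "qintegral_norm G = ereal M" "M \<ge> 0"
    and small: "M * (norm (D f) + norm (D h)) < 1 - 2 * norm (h - f - \<psi> (h - f) *\<^sub>C 1)"
  shows "\<exists>g. norm (g - 1) < 1 \<and> has_dbar G g (gauge_rhs f h g)"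
proof -
  define \<rho> where "\<rho> = M * (norm (D f) + norm (D h))"
  define \<epsilon> where "\<epsilon> = norm (h - f - \<psi> (h - f) *\<^sub>C 1)"
  have \<rho>: "0 \<le> \<rho>" "\<rho> < 1 - 2 * \<epsilon>" and \<epsilon>: "0 \<le> \<epsilon>"
    using M(2) small by (simp_all add: \<rho>_def \<epsilon>_def)
  then have "\<rho> < 1"
    by linarith
  have "\<exists>u\<in>L 0. D u = gauge_rhs f h x \<and> norm u \<le> \<rho> * norm x" if x: "x \<in> L 0" for x
  proof -
    obtain y where y: "y \<in> L 0" "D y = gauge_rhs f h x"
      using gauge_rhs_in_range[OF f h x] by blast
    obtain u where u: "u \<in> L 0" "D u = D y" "norm u \<le> M * norm (D y)"
      using bounded_primitive[OF M(1) y(1)] by blast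
    have "M * norm (D y) \<le> \<rho> * norm x"
      using mult_left_mono[OF norm_gauge_rhs[of f h x] M(2)] by (simp add: y(2) \<rho>_def mult.assoc)
    with u y show ?thesis
      by force
  qed
  \<comment> \<open>\<open>S\<close> is a mere choice of primitives, with no linearity claimed; the
    sums below rely on the additivity of \<open>D\<close> and of \<open>gauge_rhs\<close>.\<close>
  then obtain S where S: "\<And>x. x \<in> L 0 \<Longrightarrow> S x \<in> L 0"
    "\<And>x. x \<in> L 0 \<Longrightarrow> D (S x) = gauge_rhs f h x" "\<And>x. x \<in> L 0 \<Longrightarrow> norm (S x) \<le> \<rho> * norm x"
    by metis
  \<comment> \<open>A primitive of the right-hand side at 1, chosen by hand so that its norm is the
    quantity in the hypothesis.\<close>
  define w0 where "w0 = f - h + \<psi> (h - f) *\<^sub>C 1"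
  have w0: "w0 \<in> L 0" "D w0 = D f - D h" "norm w0 = \<epsilon>"
  proof -
    show "w0 \<in> L 0"
      unfolding w0_def by (intro L_add L_diff f h scalar_in_L)
    show "D w0 = D f - D h"
      unfolding w0_def using D_add[OF L_diff[OF f h] scalar_in_L] D_diff[OF f h] by (simp add: D_scalar)
    have "w0 = - (h - f - \<psi> (h - f) *\<^sub>C 1)"
      by (simp add: w0_def)
    then show "norm w0 = \<epsilon>"
      unfolding \<epsilon>_def by (metis norm_minus_cancel)
  qed
  define w where "w k = (S ^^ k) w0" for k
  have w_Suc: "w (Suc k) = S (w k)" for k
    by (simp add: w_def)
  have w: "w k \<in> L 0" for k
    by (induction k) (simp_all add: w_Suc S(1), simp add: w_def w0)
  have norm_w: "norm (w k) \<le> \<epsilon> * \<rho> ^ k" for k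
  proof (induction k)
    case (Suc k)
    have "norm (w (Suc k)) \<le> \<rho> * norm (w k)"
      unfolding w_Suc by (rule S(3)[OF w])
    also have "\<dots> \<le> \<rho> * (\<epsilon> * \<rho> ^ k)"
      by (intro mult_left_mono Suc.IH \<rho>)
    finally show ?case
      by (simp add: mult_ac)
  qed (simp add: w_def w0)
  have geometric: "(\<lambda>k. \<epsilon> * \<rho> ^ k) sums (\<epsilon> * (1 / (1 - \<rho>)))"
    using \<rho> \<open>\<rho> < 1\<close> by (intro sums_mult geometric_sums) simp
  have summable: "summable w"
    using norm_w by (intro summable_comparison_test[OF _ sums_summable[OF geometric]]) blast
  define g where "g = 1 + suminf w"
  define g' where "g' n = 1 + (\<Sum>k<n. w k)" for n
  have g': "g' n \<in> L 0" for n
    unfolding g'_def by (intro L_add L_one L_sum w)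
  \<comment> \<open>The gauge equation holds for the partial sums up to a shift of the index, which
    disappears in the limit.\<close>
  have D_g': "D (g' (Suc n)) = gauge_rhs f h (g' n)" for n
  proof (induction n)
    case 0
    then show ?case
      using D_add[OF L_one w0(1)] D_scalar[of 1] by (simp add: g'_def w_def w0 gauge_rhs_one)
  next
    case (Suc n)
    have step: "g' (Suc k) = g' k + w k" for k
      by (simp add: g'_def add.assoc)
    have "D (g' (Suc (Suc n))) = D (g' (Suc n)) + D (S (w n))"
      unfolding step[of "Suc n"] w_Suc[symmetric] by (rule D_add[OF g' w])
    also have "\<dots> = gauge_rhs f h (g' n + w n)"
      unfolding Suc.IH S(2)[OF w] gauge_rhs_add ..
    finally show ?case
      unfolding step[of n] .
  qed
  have lim: "g' \<longlonglongrightarrow> g"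
    unfolding g'_def g_def by (intro tendsto_add tendsto_const summable_LIMSEQ summable)
  have "has_dbar G g (gauge_rhs f h g)"
    unfolding has_dbar_def ACP_eq
    using g' LIMSEQ_Suc[OF lim] tendsto_gauge_rhs[OF lim]
    by (intro exI[of _ "\<lambda>n. g' (Suc n)"]) (simp add: D_g')
  moreover have "norm (g - 1) < 1"
  proof -
    have "norm (g - 1) \<le> \<epsilon> / (1 - \<rho>)"
      using norm_suminf_le[OF norm_w sums_summable[OF geometric]] sums_unique[OF geometric]
      by (simp add: g_def)
    \<comment> \<open>\<epsilon> + \<rho> < 1 follows from \<rho> < 1 - 2 \<epsilon> and \<epsilon>
      \<ge> 0.\<close>
    also have "\<dots> < 1"
      using \<rho> \<epsilon> \<open>\<rho> < 1\<close> by (simp add: divide_less_eq)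
    finally show ?thesis .
  qed
  ultimately show ?thesis
    by blast
qed

lemma gauge_equivalent_nabla:
  assumes f: "f \<in> L 0" and h: "h \<in> L 0" and nonscalar: "\<nexists>z. f - h = z *\<^sub>C 1"
    and small: "ereal (norm (D f) + norm (D h))
      < ereal (1 - 2 * norm (h - f - \<psi> (h - f) *\<^sub>C 1)) / qintegral_norm G"
  shows "gauge_equivalent G n (nabla G n f) (nabla G n h)"
proof -
  \<comment> \<open>In the extended reals a real divided by infinity is 0, and the hypothesis would
    make a sum of norms negative.\<close>
  have "qintegral_norm G \<noteq> \<infinity>"
  proof
    assume "qintegral_norm G = \<infinity>"
    then have "norm (D f) + norm (D h) < 0"
      using small by (simp add: zero_ereal_def)
    then show False
      using norm_ge_zero[of "D f"] norm_ge_zero[of "D h"] by linarith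
  qed
  with qintegral_norm_pos[OF L_diff[OF f h] nonscalar] obtain M where
    M: "qintegral_norm G = ereal M" "M > 0"
    by (cases "qintegral_norm G") auto
  then have "norm (D f) + norm (D h) < (1 - 2 * norm (h - f - \<psi> (h - f) *\<^sub>C 1)) / M"
    using small by simp
  then have "M * (norm (D f) + norm (D h)) < 1 - 2 * norm (h - f - \<psi> (h - f) *\<^sub>C 1)"
    using M(2) by (simp add: less_divide_eq mult.commute)
  then obtain g where g: "norm (g - 1) < 1" "has_dbar G g (gauge_rhs f h g)"
    using gauge_solution_exists[OF f h M(1)] M(2) by auto
  \<comment> \<open>The Neumann series is applied to u = 1 - g, which lies in the domain along with
    g.\<close>
  have "norm (1 - g) < 1"
    using g(1) by (simp add: norm_minus_commute)
  then have "invertible_in (dbar_domain G) g"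
    using Neumann_in_domain[OF has_dbar_diff[OF has_dbar_one g(2)]] by simp
  then show ?thesis
    unfolding gauge_equivalent_def mixed_gauge_solution_def
    using f h g(2) by (auto simp: ACP_eq gauge_rhs_def)
qed

end

theorem proposition4p3:
  fixes q :: real
    and G :: "('b::cstar_algebra, 'h::complex_hilbert) su2"
    and n :: int
    and f h :: 'b
  assumes "0 < q" and "q < 1"
    and "quantum_SU2 q G"
    and "f \<in> ACP G" and "h \<in> ACP G"
    and "\<nexists>z. f - h = z *\<^sub>C 1"
    and "ereal (norm (dbar G f) + norm (dbar G h))
           < min (ereal (1 / 3))
                 (ereal (1 - 2 * norm (h - f - psi_inf G (h - f) *\<^sub>C 1)) / qintegral_norm G)"
  shows "holomorphic_structure G n (nabla G n f) \<and>
         holomorphic_structure G n (nabla G n h) \<and>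
         gauge_equivalent G n (nabla G n f) (nabla G n h)"
proof -
  interpret quantum_su2 q G
    using assms(1-3) by unfold_locales
  show ?thesis
    using assms(4-7) holomorphic_structure_nabla gauge_equivalent_nabla[of f h n]
    by (simp add: ACP_eq)
qed

end
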